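(* Let $\mu_1,\mu_2$ be an Angelesco system on $[a_1,b_1]$, $[a_2,b_2]$ with $b_1\le a_2$. Suppose that the Hermite--Padé approximants $$\sum_{j=1}^{2n}\frac{\lambda_{j,2n}^{(1)}}{z-x_{j,2n}},\qquad \sum_{j=1}^{2n}\frac{\lambda_{j,2n}^{(2)}}{z-x_{j,2n}}$$ converge, as $n\to\infty$, to $g_1(z)=\int_{a_1}^{b_1}\frac{d\mu_1(x)}{z-x}$ and $g_2(z)=\int_{a_2}^{b_2}\frac{d\mu_2(x)}{z-x}$ respectively, uniformly on compact subsets of $\Omega=\mathbb{C}\setminus E^*$, where $E^*$ is a closed set containing $[a_1,b_1]\cup[a_2,b_2]$. If $f$ is analytic in a domain that contains $E^*$, then $$\lim_{n\to\infty}\sum_{j=1}^{2n}\lambda_{j,2n}^{(1)}f(x_{j,2n})=\int_{a_1}^{b_1}f(x)\,d\mu_1(x)$$ and $$\lim_{n\to\infty}\sum_{j=1}^{2n}\lambda_{j,2n}^{(2)}f(x_{j,2n})=\int_{a_2}^{b_2}f(x)\,d\mu_2(x).$$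
   Context: Setting: $-\infty<a_1<b_1\le a_2<b_2<\infty$, and $\mu_1,\mu_2$ are finite positive Borel measures with infinite support, $\mathrm{supp}(\mu_j)\subset[a_j,b_j]$ (an Angelesco system). For $n\ge1$, $P_{n,n}$ is the (unique) monic polynomial of degree $2n$ with $\int P_{n,n}(x)x^k\,d\mu_j(x)=0$ for $0\le k\le n-1$ and $j=1,2$. It is known that $P_{n,n}$ has $n$ simple zeros in $(a_1,b_1)$ and $n$ simple zeros in $(a_2,b_2)$; they are denoted in increasing order $x_{1,2n}<\dots<x_{n,2n}$ (in $(a_1,b_1)$) and $x_{n+1,2n}<\dots<x_{2n,2n}$ (in $(a_2,b_2)$). The quadrature weights are $\lambda_{k,2n}^{(j)}=\int \ell_{k,2n}(x)\,d\mu_j(x)$, $1\le k\le 2n$, $j=1,2$, where $\ell_{k,2n}$ is the polynomial of degree at most $2n-1$ with $\ell_{k,2n}(x_{i,2n})=\delta_{i,k}$. Consequently $\sum_{k=1}^{2n}\lambda_{k,2n}^{(j)}P(x_{k,2n})=\int P\,d\mu_j$ for every polynomial $P$ of degree at most $3n-1$. The Hermite--Padé approximants above equal $Q_{2n-1}(z)/P_{n,n}(z)$ and $R_{2n-1}(z)/P_{n,n}(z)$, with $Q_{2n-1}(z)=\int\frac{P_{n,n}(z)-P_{n,n}(x)}{z-x}\,d\mu_1(x)$ and $R_{2n-1}(z)=\int\frac{P_{n,n}(z)-P_{n,n}(x)}{z-x}\,d\mu_2(x)$. *)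

theory Defs
  imports "HOL-Analysis.Analysis" "HOL-Computational_Algebra.Polynomial"
begin

definition measure_support :: "'a::topological_space measure \<Rightarrow> 'a set" where
  "measure_support \<mu> = {x. \<forall>U. open U \<longrightarrow> x \<in> U \<longrightarrow> emeasure \<mu> U > 0}"

definition angelesco_system ::
  "real measure \<Rightarrow> real measure \<Rightarrow> real \<Rightarrow> real \<Rightarrow> real \<Rightarrow> real \<Rightarrow> bool" where
  "angelesco_system \<mu>1 \<mu>2 a1 b1 a2 b2 \<longleftrightarrow>
     a1 < b1 \<and> b1 \<le> a2 \<and> a2 < b2 \<and>
     finite_measure \<mu>1 \<and> sets \<mu>1 = sets borel \<and>
     infinite (measure_support \<mu>1) \<and> measure_support \<mu>1 \<subseteq> {a1..b1} \<and>
     finite_measure \<mu>2 \<and> sets \<mu>2 = sets borel \<and>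
     infinite (measure_support \<mu>2) \<and> measure_support \<mu>2 \<subseteq> {a2..b2}"

definition mop_diag :: "real measure \<Rightarrow> real measure \<Rightarrow> nat \<Rightarrow> real poly" where
  "mop_diag \<mu>1 \<mu>2 n =
     (THE p. degree p = 2 * n \<and> lead_coeff p = 1 \<and>
        (\<forall>k<n. (LINT x|\<mu>1. poly p x * x ^ k) = 0 \<and> (LINT x|\<mu>2. poly p x * x ^ k) = 0))"

text \<open>The nodes \<open>x\<^sub>k\<^sub>,\<^sub>2\<^sub>n\<close>: all zeros of \<open>P\<^sub>n\<^sub>,\<^sub>n\<close> in increasing order, with \<open>k\<close> counted from 1.
  As \<open>b1 \<le> a2\<close>, the zeros in \<open>(a1, b1)\<close> are the first ones.\<close>

definition node :: "real measure \<Rightarrow> real measure \<Rightarrow> nat \<Rightarrow> nat \<Rightarrow> real" where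
  "node \<mu>1 \<mu>2 n k = sorted_list_of_set {x. poly (mop_diag \<mu>1 \<mu>2 n) x = 0} ! (k - 1)"

definition fundamental_poly :: "real measure \<Rightarrow> real measure \<Rightarrow> nat \<Rightarrow> nat \<Rightarrow> real poly" where
  "fundamental_poly \<mu>1 \<mu>2 n k =
     (THE l. degree l \<le> 2 * n - 1 \<and>
        (\<forall>i\<in>{1..2*n}. poly l (node \<mu>1 \<mu>2 n i) = (if i = k then 1 else 0)))"

text \<open>In the next two definitions \<open>\<nu>\<close> is the measure that is integrated, \<open>\<mu>1\<close> or \<open>\<mu>2\<close>.\<close>

definition quad_weight ::
  "real measure \<Rightarrow> real measure \<Rightarrow> real measure \<Rightarrow> nat \<Rightarrow> nat \<Rightarrow> real" where
  "quad_weight \<mu>1 \<mu>2 \<nu> n k = (LINT x|\<nu>. poly (fundamental_poly \<mu>1 \<mu>2 n k) x)"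

definition hp_approx ::
  "real measure \<Rightarrow> real measure \<Rightarrow> real measure \<Rightarrow> nat \<Rightarrow> complex \<Rightarrow> complex" where
  "hp_approx \<mu>1 \<mu>2 \<nu> n z =
     (\<Sum>j = 1..2*n. of_real (quad_weight \<mu>1 \<mu>2 \<nu> n j) / (z - of_real (node \<mu>1 \<mu>2 n j)))"

definition markov_function :: "real measure \<Rightarrow> real \<Rightarrow> real \<Rightarrow> complex \<Rightarrow> complex" where
  "markov_function \<mu> a b z = (LINT x:{a..b}|\<mu>. 1 / (z - of_real x))"

end

theory Submission
  imports Defs "HOL-Complex_Analysis.Complex_Analysis"
begin

text \<open>The quadrature sum and the integral are both Cauchy integrals of \<open>f\<close>. If \<open>\<Gamma>\<close> is a cycle
  in the domain of \<open>f\<close> that surrounds the nodes and the intervals once, then Cauchy's formula at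
  each node and at each point of \<open>[a, b]\<close> turns the sum \<open>\<Sum>\<lambda>\<^sub>j f(x\<^sub>j)\<close> into \<open>1/(2\<pi>i)\<close> times the
  integral of \<open>f\<close> times the Hermite--Pade approximant over \<open>\<Gamma>\<close>, and it turns \<open>\<integral>f d\<nu>\<close> into
  \<open>1/(2\<pi>i)\<close> times the integral of \<open>f\<close> times the Markov function (\<open>contour_integral_markov_function\<close>,
  by Fubini). Uniform convergence of the approximants on \<open>\<Gamma>\<close> then gives the result
  (\<open>quadrature_converges\<close>). Approximating \<open>f\<close> on the intervals by polynomials would not do, since
  the weights can have both signs and the sums \<open>\<Sum>\<bar>\<lambda>\<^sub>j\<bar>\<close> are not known to be bounded.

  Three points need work. First, \<open>E\<close> is only closed, and when it is unbounded no cycle avoids \<open>E\<close>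
  and surrounds it. However, far from the intervals the approximants always converge: by
  interpolation of \<open>x \<mapsto> 1 / (z - x)\<close> the error at \<open>z\<close> is
  \<open>- 1 / P(z) \<integral>P(x) / (z - x) d\<nu>(x)\<close> with \<open>P\<close> the node polynomial (\<open>hp_approx_error\<close>), and this decays
  geometrically once \<open>z\<close> is farther than \<open>b2 - a1\<close> from \<open>[a1, b2]\<close>
  (\<open>hp_approx_converges_far\<close>). So \<open>E\<close> may be replaced by the compact set \<open>K = E \<inter> cball 0 R\<close>, off
  which the convergence is still locally uniform.

  Second, the cycle: for a compact set \<open>K\<close> in an open set \<open>D\<close> take all squares of a fine grid that
  meet \<open>K\<close>, and keep the sides that belong to only one of them. These sides avoid \<open>K\<close>, and the sum
  of Cauchy's formula over the squares shows that they represent \<open>f\<close> on \<open>K\<close>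
  (\<open>cauchy_formula_compact\<close>).

  Third, the nodes and the fundamental polynomials are introduced by definite descriptions, so that
  the classical facts about Angelesco systems have to be established: the orthogonality relations
  force \<open>n\<close> zeros in each open interval (\<open>orthogonal_poly_roots\<close>), which bounds the degree of every
  nonzero solution from below by \<open>2n\<close> (\<open>multiple_orthogonal_roots\<close>). Uniqueness follows at once,
  and existence follows as there are \<open>2n\<close> linear conditions on \<open>2n + 1\<close> coefficients
  (\<open>mop_diag\<close>).\<close>

section \<open>Cauchy's formula around a compact set\<close>

text \<open>The side of the square with centre \<open>c\<close> that is traversed in direction \<open>u\<close>, where \<open>u\<close> is one of
  \<open>\<plusminus>\<delta>\<close>, \<open>\<plusminus>i\<delta>\<close>, with the square on its left. In this parametrization the same side with the opposite
  orientation is the side in direction \<open>-u\<close> of the neighbouring square, whose centre is \<open>c - iu\<close>; no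
  case distinction over the four sides is needed to see which sides cancel.\<close>

definition square_edge :: "complex \<Rightarrow> complex \<Rightarrow> complex \<times> complex" where
  "square_edge c u = (c - (1 + \<i>) * u / 2, c + (1 - \<i>) * u / 2)"

definition grid_square :: "real \<Rightarrow> complex \<Rightarrow> complex set" where
  "grid_square \<delta> c = cbox (c - Complex (\<delta>/2) (\<delta>/2)) (c + Complex (\<delta>/2) (\<delta>/2))"

definition square_lattice :: "real \<Rightarrow> complex set" where
  "square_lattice \<delta> = {Complex (\<delta> * of_int m) (\<delta> * of_int n) | m n. True}"

definition edge_vectors :: "real \<Rightarrow> complex set" where
  "edge_vectors \<delta> = {Complex \<delta> 0, Complex 0 \<delta>, Complex (- \<delta>) 0, Complex 0 (- \<delta>)}"

abbreviation edge_integral :: "complex \<times> complex \<Rightarrow> (complex \<Rightarrow> complex) \<Rightarrow> complex" where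
  "edge_integral e g \<equiv> contour_integral (linepath (fst e) (snd e)) g"

lemma mem_grid_square:
  "z \<in> grid_square \<delta> c \<longleftrightarrow> \<bar>Re z - Re c\<bar> \<le> \<delta>/2 \<and> \<bar>Im z - Im c\<bar> \<le> \<delta>/2"
  unfolding grid_square_def in_cbox_complex_iff by (simp add: abs_if) argo

lemma interior_grid_square:
  "z \<in> interior (grid_square \<delta> c) \<longleftrightarrow> \<bar>Re z - Re c\<bar> < \<delta>/2 \<and> \<bar>Im z - Im c\<bar> < \<delta>/2"
  unfolding grid_square_def interior_cbox in_box_complex_iff by (simp add: abs_if) argo

lemma inj_square_edge: "inj (\<lambda>(c, u). square_edge c u)"
proof (rule injI, clarsimp simp: square_edge_def)
  fix c u c' u' :: complex
  assume 1: "c - (1 + \<i>) * u / 2 = c' - (1 + \<i>) * u' / 2"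
    and 2: "c + (1 - \<i>) * u / 2 = c' + (1 - \<i>) * u' / 2"
  have "(c + (1 - \<i>) * u / 2) - (c - (1 + \<i>) * u / 2) = u" for c u :: complex
    by (simp add: field_simps)
  from this[of c u] this[of c' u'] 1 2 have "u = u'" by simp
  with 1 show "c = c' \<and> u = u'" by simp
qed

lemma swap_square_edge: "prod.swap (square_edge c u) = square_edge (c - \<i> * u) (- u)"
  by (simp add: square_edge_def field_simps)

lemma finite_squares_meeting_bounded:
  assumes "\<delta> > 0" "bounded K"
  shows "finite {c \<in> square_lattice \<delta>. grid_square \<delta> c \<inter> K \<noteq> {}}"
proof -
  obtain B where B: "\<And>z. z \<in> K \<Longrightarrow> norm z \<le> B"
    using assms(2) by (auto simp: bounded_iff)
  define N where "N = \<lceil>B / \<delta> + 1\<rceil>"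
  have aux: "\<bar>m\<bar> \<le> N" if "\<bar>y - \<delta> * of_int m\<bar> \<le> \<delta> / 2" "\<bar>y\<bar> \<le> B" for m y
  proof -
    have "\<delta> * \<bar>of_int m\<bar> \<le> B + \<delta>"
      using that assms(1) by (auto simp: abs_mult[symmetric] abs_le_iff abs_if split: if_splits)
    then have "\<bar>of_int m\<bar> \<le> B / \<delta> + 1"
      using assms(1) by (simp add: field_simps)
    then have "of_int \<bar>m\<bar> \<le> (of_int N :: real)" unfolding N_def by linarith
    then show ?thesis by linarith
  qed
  have "{c \<in> square_lattice \<delta>. grid_square \<delta> c \<inter> K \<noteq> {}}
      \<subseteq> (\<lambda>(m, n). Complex (\<delta> * of_int m) (\<delta> * of_int n)) ` ({-N..N} \<times> {-N..N})"
  proof (clarsimp simp: square_lattice_def)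
    fix m n :: int
    assume "grid_square \<delta> (Complex (\<delta> * of_int m) (\<delta> * of_int n)) \<inter> K \<noteq> {}"
    then obtain z where z: "z \<in> K" "\<bar>Re z - \<delta> * of_int m\<bar> \<le> \<delta>/2" "\<bar>Im z - \<delta> * of_int n\<bar> \<le> \<delta>/2"
      by (auto simp: mem_grid_square)
    have "\<bar>m\<bar> \<le> N" "\<bar>n\<bar> \<le> N"
      using aux[OF z(2)] aux[OF z(3)] B[OF z(1)] abs_Re_le_cmod[of z] abs_Im_le_cmod[of z] by auto
    then show "Complex (\<delta> * of_int m) (\<delta> * of_int n) \<in>
       (\<lambda>x. case x of (m, n) \<Rightarrow> Complex (\<delta> * of_int m) (\<delta> * of_int n)) ` ({- N..N} \<times> {- N..N})"
      by (intro image_eqI[of _ _ "(m, n)"]) auto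
  qed
  then show ?thesis by (rule finite_subset) auto
qed

lemma grid_squares_cover:
  assumes "\<delta> > 0"
  obtains c where "c \<in> square_lattice \<delta>" "z \<in> grid_square \<delta> c"
proof -
  have aux: "\<bar>y - \<delta> * of_int (round (y / \<delta>))\<bar> \<le> \<delta> / 2" for y
  proof -
    have "\<delta> * \<bar>of_int (round (y / \<delta>)) - y / \<delta>\<bar> \<le> \<delta> * (1/2)"
      using of_int_round_abs_le[of "y / \<delta>"] assms by (intro mult_left_mono) auto
    then have "\<bar>\<delta> * (of_int (round (y / \<delta>)) - y / \<delta>)\<bar> \<le> \<delta> / 2"
      using assms by (simp add: abs_mult)
    then show ?thesis using assms by (simp add: right_diff_distrib abs_minus_commute)
  qed
  show ?thesis
    by (rule that[of "Complex (\<delta> * of_int (round (Re z / \<delta>))) (\<delta> * of_int (round (Im z / \<delta>)))"])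
       (use aux[of "Re z"] aux[of "Im z"] in \<open>auto simp: square_lattice_def mem_grid_square\<close>)
qed

lemma interior_grid_square_disjoint:
  assumes "\<delta> > 0" "c \<in> square_lattice \<delta>" "c' \<in> square_lattice \<delta>"
    and "z \<in> interior (grid_square \<delta> c)" "z \<in> grid_square \<delta> c'"
  shows "c = c'"
proof -
  have aux: "m = m'"
    if "\<bar>y - \<delta> * of_int m\<bar> < \<delta> / 2" "\<bar>y - \<delta> * of_int m'\<bar> \<le> \<delta> / 2" for y and m m' :: int
  proof -
    have "\<bar>\<delta> * (of_int m - of_int m')\<bar> < \<delta>"
      using that unfolding right_diff_distrib by linarith
    then have "\<delta> * \<bar>of_int m - of_int m'\<bar> < \<delta> * 1" using assms(1) by (simp add: abs_mult)
    then have "\<bar>of_int m - of_int m'\<bar> < (1::real)" using assms(1) mult_less_cancel_left_pos by blast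
    then show ?thesis by linarith
  qed
  show ?thesis
    using assms(2-5) aux by (auto simp: square_lattice_def mem_grid_square interior_grid_square)
qed

lemma square_lattice_neighbour:
  assumes "c \<in> square_lattice \<delta>" "u \<in> edge_vectors \<delta>"
  shows "c - \<i> * u \<in> square_lattice \<delta>"
proof -
  obtain m n where c: "c = Complex (\<delta> * of_int m) (\<delta> * of_int n)"
    using assms(1) by (auto simp: square_lattice_def)
  have "c - \<i> * Complex \<delta> 0 = Complex (\<delta> * of_int m) (\<delta> * of_int (n - 1))"
       "c - \<i> * Complex 0 \<delta> = Complex (\<delta> * of_int (m + 1)) (\<delta> * of_int n)"
       "c - \<i> * Complex (-\<delta>) 0 = Complex (\<delta> * of_int m) (\<delta> * of_int (n + 1))"
       "c - \<i> * Complex 0 (-\<delta>) = Complex (\<delta> * of_int (m - 1)) (\<delta> * of_int n)"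
    by (auto simp: c complex_eq_iff algebra_simps)
  with assms(2) show ?thesis
    unfolding edge_vectors_def square_lattice_def by blast
qed

lemma square_edge_corners:
  assumes "u \<in> edge_vectors \<delta>"
  shows "\<bar>Re (fst (square_edge c u)) - Re c\<bar> = \<bar>\<delta>\<bar>/2" "\<bar>Im (fst (square_edge c u)) - Im c\<bar> = \<bar>\<delta>\<bar>/2"
    "\<bar>Re (snd (square_edge c u)) - Re c\<bar> = \<bar>\<delta>\<bar>/2" "\<bar>Im (snd (square_edge c u)) - Im c\<bar> = \<bar>\<delta>\<bar>/2"
  using assms by (auto simp: edge_vectors_def square_edge_def abs_if)

lemma square_edge_subset:
  assumes "\<delta> > 0" "u \<in> edge_vectors \<delta>"
  shows "closed_segment (fst (square_edge c u)) (snd (square_edge c u)) \<subseteq> grid_square \<delta> c"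
  using square_edge_corners[OF assms(2), of c] assms(1)
  by (intro closed_segment_subset) (auto simp: mem_grid_square, simp add: grid_square_def)

lemma rectpath_square_edges:
  assumes "\<delta> > 0"
  defines "\<gamma> \<equiv> \<lambda>c. rectpath (c - Complex (\<delta>/2) (\<delta>/2)) (c + Complex (\<delta>/2) (\<delta>/2))"
  assumes cont: "continuous_on (path_image (\<gamma> c)) g"
  shows "contour_integral (\<gamma> c) g = (\<Sum>u\<in>edge_vectors \<delta>. edge_integral (square_edge c u) g)"
    and "\<And>u. u \<in> edge_vectors \<delta> \<Longrightarrow>
           closed_segment (fst (square_edge c u)) (snd (square_edge c u)) \<subseteq> path_image (\<gamma> c)"
proof -
  let ?e = "square_edge c"
  let ?l = "\<lambda>u. linepath (fst (?e u)) (snd (?e u))"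
  have dec: "\<gamma> c = ?l (Complex \<delta> 0) +++ ?l (Complex 0 \<delta>) +++ ?l (Complex (-\<delta>) 0) +++ ?l (Complex 0 (-\<delta>))"
    unfolding \<gamma>_def rectpath_def Let_def square_edge_def
    by (intro arg_cong2[where f = "(+++)"] arg_cong2[where f = linepath])
       (auto simp: complex_eq_iff field_simps)
  have sum: "(\<Sum>u\<in>edge_vectors \<delta>. h u)
      = h (Complex \<delta> 0) + (h (Complex 0 \<delta>) + (h (Complex (-\<delta>) 0) + h (Complex 0 (-\<delta>))))"
    for h :: "complex \<Rightarrow> complex"
    using assms(1) by (simp add: edge_vectors_def complex_eq_iff)
  have joins: "pathfinish (?l (Complex \<delta> 0)) = pathstart (?l (Complex 0 \<delta>))"
       "pathfinish (?l (Complex 0 \<delta>)) = pathstart (?l (Complex (-\<delta>) 0))"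
       "pathfinish (?l (Complex (-\<delta>) 0)) = pathstart (?l (Complex 0 (-\<delta>)))"
    by (auto simp: square_edge_def complex_eq_iff field_simps)
  have pi: "path_image (\<gamma> c) = path_image (?l (Complex \<delta> 0)) \<union> (path_image (?l (Complex 0 \<delta>))
       \<union> (path_image (?l (Complex (-\<delta>) 0)) \<union> path_image (?l (Complex 0 (-\<delta>)))))"
    unfolding dec using joins by (simp add: path_image_join)
  show sub: "closed_segment (fst (?e u)) (snd (?e u)) \<subseteq> path_image (\<gamma> c)"
    if "u \<in> edge_vectors \<delta>" for u
    using that unfolding pi edge_vectors_def by auto
  have int: "g contour_integrable_on ?l u" if "u \<in> edge_vectors \<delta>" for u
    using continuous_on_subset[OF cont sub[OF that]] by (rule contour_integrable_continuous_linepath)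
  have "g contour_integrable_on ?l (Complex \<delta> 0)" "g contour_integrable_on ?l (Complex 0 \<delta>)"
    "g contour_integrable_on ?l (Complex (-\<delta>) 0)" "g contour_integrable_on ?l (Complex 0 (-\<delta>))"
    by (auto intro!: int simp: edge_vectors_def)
  then show "contour_integral (\<gamma> c) g = (\<Sum>u\<in>edge_vectors \<delta>. edge_integral (?e u) g)"
    unfolding dec sum using joins by simp
qed

text \<open>A point on the boundary of the square is excluded; such points are reached later by continuity.\<close>

lemma cauchy_formula_grid_square:
  assumes "\<delta> > 0" and holf: "f holomorphic_on grid_square \<delta> c"
    and z: "z \<in> interior (grid_square \<delta> c) \<or> z \<notin> grid_square \<delta> c"
  shows "(\<Sum>u\<in>edge_vectors \<delta>. edge_integral (square_edge c u) (\<lambda>w. f w / (w - z)))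
           = (if z \<in> grid_square \<delta> c then 2 * pi * \<i> * f z else 0)"
    and "\<And>u. u \<in> edge_vectors \<delta> \<Longrightarrow> continuous_on
           (closed_segment (fst (square_edge c u)) (snd (square_edge c u))) (\<lambda>w. f w / (w - z))"
proof -
  let ?a = "c - Complex (\<delta>/2) (\<delta>/2)" and ?b = "c + Complex (\<delta>/2) (\<delta>/2)"
  have le: "Re ?a \<le> Re ?b" "Im ?a \<le> Im ?b" using assms(1) by auto
  have sub: "path_image (rectpath ?a ?b) \<subseteq> grid_square \<delta> c - {z}"
    using z path_image_rectpath_cbox_minus_box[OF le] by (auto simp: grid_square_def)
  have cont: "continuous_on (path_image (rectpath ?a ?b)) (\<lambda>w. f w / (w - z))"
    using sub holomorphic_on_imp_continuous_on[OF holf]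
    by (intro continuous_intros) (auto elim: continuous_on_subset)
  show "continuous_on (closed_segment (fst (square_edge c u)) (snd (square_edge c u))) (\<lambda>w. f w / (w - z))"
    if "u \<in> edge_vectors \<delta>" for u
    using rectpath_square_edges(2)[OF assms(1) cont that] cont continuous_on_subset by blast
  have "contour_integral (rectpath ?a ?b) (\<lambda>w. f w / (w - z))
           = (if z \<in> grid_square \<delta> c then 2 * pi * \<i> * f z else 0)"
  proof (cases "z \<in> grid_square \<delta> c")
    case True
    with z have "z \<in> box ?a ?b" by (simp add: grid_square_def)
    have "((\<lambda>w. f w / (w - z)) has_contour_integral
             (2 * pi * \<i> * winding_number (rectpath ?a ?b) z * f z)) (rectpath ?a ?b)"
      using True z sub
      by (intro Cauchy_integral_formula_convex_simple[OF _ holf]) (auto simp: grid_square_def)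
    with True winding_number_rectpath[OF \<open>z \<in> box ?a ?b\<close>] show ?thesis
      by (simp add: contour_integral_unique)
  next
    case False
    have "((\<lambda>w. f w / (w - z)) has_contour_integral 0) (rectpath ?a ?b)"
      using False sub
      by (intro Cauchy_theorem_convex_simple[where S = "grid_square \<delta> c"])
         (auto simp: grid_square_def intro!: holomorphic_intros holf[unfolded grid_square_def])
    with False show ?thesis by (simp add: contour_integral_unique)
  qed
  with rectpath_square_edges(1)[OF assms(1) cont]
  show "(\<Sum>u\<in>edge_vectors \<delta>. edge_integral (square_edge c u) (\<lambda>w. f w / (w - z)))
           = (if z \<in> grid_square \<delta> c then 2 * pi * \<i> * f z else 0)" by simp
qed

text \<open>The map \<open>(c, u) \<mapsto> (c - iu, -u)\<close> is an involution on the sides that are shared by two squares of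
  \<open>C\<close>, and it changes the sign of \<open>h\<close>. So the sum over the shared sides is its own negative.\<close>

lemma sum_edges_cancel:
  assumes "finite C" "finite U" and U: "\<And>u. u \<in> U \<Longrightarrow> - u \<in> U"
    and anti: "\<And>c u. c \<in> C \<Longrightarrow> u \<in> U \<Longrightarrow>
                 h (square_edge (c - \<i> * u) (- u)) = - (h (square_edge c u) :: complex)"
  shows "(\<Sum>c\<in>C. \<Sum>u\<in>U. h (square_edge c u))
           = (\<Sum>(c, u) \<in> {(c, u) \<in> C \<times> U. c - \<i> * u \<notin> C}. h (square_edge c u))"
proof -
  let ?I = "{(c, u) \<in> C \<times> U. c - \<i> * u \<in> C}" and ?J = "{(c, u) \<in> C \<times> U. c - \<i> * u \<notin> C}"
  let ?s = "\<lambda>(c, u). (c - \<i> * u, - u)"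
  have fin: "finite ?I" "finite ?J"
    using finite_cartesian_product[OF assms(1,2)] by (auto elim: finite_subset[rotated])
  have "(\<Sum>(c, u)\<in>?I. h (square_edge c u)) = (\<Sum>(c, u)\<in>?I. h (square_edge (c - \<i> * u) (- u)))"
    by (rule sum.reindex_bij_witness[of _ ?s ?s]) (auto intro: U)
  also have "\<dots> = (\<Sum>(c, u)\<in>?I. - h (square_edge c u))"
    by (rule sum.cong) (auto intro: anti)
  finally have zero: "(\<Sum>(c, u)\<in>?I. h (square_edge c u)) = 0"
    by (simp add: case_prod_unfold sum_negf)
  have "(\<Sum>c\<in>C. \<Sum>u\<in>U. h (square_edge c u)) = (\<Sum>(c, u)\<in>?I \<union> ?J. h (square_edge c u))"
    by (subst sum.cartesian_product) (rule sum.cong, auto)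
  also have "\<dots> = (\<Sum>(c, u)\<in>?I. h (square_edge c u)) + (\<Sum>(c, u)\<in>?J. h (square_edge c u))"
    by (rule sum.union_disjoint) (use fin in auto)
  finally show ?thesis using zero by simp
qed

text \<open>The derivative with respect to \<open>z\<close> can be taken under the integral sign.\<close>

lemma continuous_on_cauchy_transform_linepath:
  assumes "continuous_on (closed_segment p q) f"
  shows "continuous_on (- closed_segment p q)
           (\<lambda>z. contour_integral (linepath p q) (\<lambda>w. f w / (w - z)))"
proof (rule continuous_at_imp_continuous_on, intro ballI)
  fix z assume "z \<in> - closed_segment p q"
  have "((\<lambda>w. f w / (w - z) ^ 1) has_contour_integral
           contour_integral (linepath p q) (\<lambda>w. f w / (w - z))) (linepath p q)"
    if "z \<notin> closed_segment p q" for z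
    using that assms
    by (auto intro!: has_contour_integral_integral contour_integrable_continuous_linepath continuous_intros)
  then have "((\<lambda>z. contour_integral (linepath p q) (\<lambda>w. f w / (w - z))) has_field_derivative
      (of_nat 1 * contour_integral (linepath p q) (\<lambda>w. f w / (w - z) ^ (Suc 1)))) (at z)"
    using \<open>z \<in> - closed_segment p q\<close> assms
    by (intro Cauchy_next_derivative(2)[where S = UNIV and B = "norm (q - p)"]) auto
  then show "isCont (\<lambda>z. contour_integral (linepath p q) (\<lambda>w. f w / (w - z))) z"
    by (rule DERIV_isCont)
qed

text \<open>Take the squares of a grid that meet \<open>K\<close>, with a mesh so small that they lie in \<open>D\<close>. The sides
  that remain after cancellation cannot meet \<open>K\<close>: the square on the other side of such a side
  would then meet \<open>K\<close> too. For a point inside one of the squares the formula is the sum of Cauchy's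
  formulas for the single squares. A point of \<open>K\<close> on a grid line is a limit of such inner points, and
  both sides of the formula are continuous off the remaining sides.\<close>

theorem cauchy_formula_compact:
  fixes K D :: "complex set" and f :: "complex \<Rightarrow> complex"
  assumes "compact K" "open D" "K \<subseteq> D" and holf: "f holomorphic_on D"
  obtains J :: "(complex \<times> complex) set" where "finite J"
    and "\<And>e. e \<in> J \<Longrightarrow> closed_segment (fst e) (snd e) \<subseteq> D - K"
    and "\<And>z. z \<in> K \<Longrightarrow> 2 * pi * \<i> * f z = (\<Sum>e\<in>J. edge_integral e (\<lambda>w. f w / (w - z)))"
proof -
  obtain \<epsilon> where \<epsilon>: "\<epsilon> > 0" "(\<Union>x\<in>K. ball x \<epsilon>) \<subseteq> D"
    using compact_subset_open_imp_ball_epsilon_subset[OF assms(1-3)] by blast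
  \<comment> \<open>two points of a square of side \<open>\<delta>\<close> are at distance at most \<open>2\<delta>\<close>, which must be below \<open>\<epsilon>\<close>\<close>
  define \<delta> where "\<delta> = \<epsilon> / 3"
  have \<delta>: "\<delta> > 0" using \<epsilon> by (simp add: \<delta>_def)
  define C where "C = {c \<in> square_lattice \<delta>. grid_square \<delta> c \<inter> K \<noteq> {}}"
  have finC: "finite C"
    unfolding C_def using \<delta> compact_imp_bounded[OF assms(1)] by (rule finite_squares_meeting_bounded)
  let ?U = "edge_vectors \<delta>"
  have sqD: "grid_square \<delta> c \<subseteq> D" if c: "c \<in> C" for c
  proof
    fix z assume z: "z \<in> grid_square \<delta> c"
    obtain x where x: "x \<in> K" "x \<in> grid_square \<delta> c" using c by (auto simp: C_def)
    have "norm (x - z) \<le> \<bar>Re (x - z)\<bar> + \<bar>Im (x - z)\<bar>" by (rule cmod_le)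
    also have "\<dots> \<le> \<delta> + \<delta>" using z x(2) unfolding mem_grid_square minus_complex.sel by linarith
    also have "\<dots> < \<epsilon>" using \<epsilon>(1) by (simp add: \<delta>_def)
    finally have "z \<in> ball x \<epsilon>" by (simp add: dist_norm)
    with x(1) \<epsilon>(2) show "z \<in> D" by blast
  qed
  define J where "J = {(c, u) \<in> C \<times> ?U. c - \<i> * u \<notin> C}"
  define S where "S = (\<lambda>(c, u). square_edge c u) ` J"
  have finJ: "finite J"
    by (rule finite_subset[of _ "C \<times> ?U"]) (use finC in \<open>auto simp: J_def edge_vectors_def\<close>)
  have SK: "closed_segment (fst e) (snd e) \<subseteq> D - K" if e: "e \<in> S" for e
  proof -
    obtain c u where cu: "e = square_edge c u" "c \<in> C" "u \<in> ?U" "c - \<i> * u \<notin> C"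
      using e by (auto simp: S_def J_def)
    have 1: "closed_segment (fst e) (snd e) \<subseteq> grid_square \<delta> c"
      unfolding cu(1) by (rule square_edge_subset[OF \<delta> cu(3)])
    have "- u \<in> ?U" using cu(3) by (auto simp: edge_vectors_def complex_eq_iff)
    then have "closed_segment (snd e) (fst e) \<subseteq> grid_square \<delta> (c - \<i> * u)"
      using square_edge_subset[OF \<delta>, of "- u" "c - \<i> * u"] swap_square_edge[of c u]
      by (metis cu(1) fst_swap snd_swap)
    moreover have "grid_square \<delta> (c - \<i> * u) \<inter> K = {}"
      using cu square_lattice_neighbour[of c \<delta> u] by (auto simp: C_def)
    \<comment> \<open>the side lies in both squares, one of which is in \<open>D\<close> while the other misses \<open>K\<close>\<close>
    ultimately show ?thesis using 1 sqD[OF cu(2)] by (auto simp: closed_segment_commute)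
  qed
  let ?G = "\<lambda>z. \<Sum>e\<in>S. edge_integral e (\<lambda>w. f w / (w - z))"
  have inner: "2 * pi * \<i> * f z = ?G z" if c0: "c0 \<in> C" and z: "z \<in> interior (grid_square \<delta> c0)" for c0 z
  proof -
    have zc: "z \<in> interior (grid_square \<delta> c) \<or> z \<notin> grid_square \<delta> c" if "c \<in> C" for c
      using interior_grid_square_disjoint[OF \<delta>, of c0 c z] that c0 z by (auto simp: C_def)
    have only: "z \<in> grid_square \<delta> c \<longleftrightarrow> c = c0" if "c \<in> C" for c
      using interior_grid_square_disjoint[OF \<delta>, of c0 c z] that c0 z interior_subset[of "grid_square \<delta> c0"]
      by (auto simp: C_def)
    let ?h = "\<lambda>e. edge_integral e (\<lambda>w. f w / (w - z))"
    note cauchy = cauchy_formula_grid_square[OF \<delta> holomorphic_on_subset[OF holf sqD] zc]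
    have "2 * pi * \<i> * f z = (\<Sum>c\<in>C. if c = c0 then 2 * pi * \<i> * f z else 0)"
      using c0 finC by simp
    also have "\<dots> = (\<Sum>c\<in>C. \<Sum>u\<in>?U. ?h (square_edge c u))"
      by (intro sum.cong refl) (simp add: cauchy(1) only)
    also have "\<dots> = (\<Sum>(c, u)\<in>J. ?h (square_edge c u))"
      unfolding J_def
    proof (rule sum_edges_cancel[OF finC])
      fix c u assume cu: "c \<in> C" "u \<in> ?U"
      have "?h (prod.swap (square_edge c u)) = - ?h (square_edge c u)"
        using contour_integral_reverse_linepath[OF cauchy(2)[OF cu(1) cu(1) cu(2)]] by simp
      then show "?h (square_edge (c - \<i> * u) (- u)) = - ?h (square_edge c u)"
        by (simp only: swap_square_edge)
    qed (auto simp: edge_vectors_def complex_eq_iff)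
    also have "\<dots> = ?G z"
      unfolding S_def using inj_on_subset[OF inj_square_edge]
      by (subst sum.reindex) (auto simp: case_prod_unfold)
    finally show ?thesis .
  qed
  have formula: "2 * pi * \<i> * f z = ?G z" if z: "z \<in> K" for z
  proof -
    obtain c where c: "c \<in> square_lattice \<delta>" "z \<in> grid_square \<delta> c" using grid_squares_cover[OF \<delta>] .
    with z have cC: "c \<in> C" by (auto simp: C_def)
    let ?T = "D - (\<Union>e\<in>S. closed_segment (fst e) (snd e))"
    have oT: "open ?T"
      using assms(2) finJ by (intro open_Diff closed_UN) (auto simp: S_def)
    have "z \<in> ?T" using z assms(3) SK by auto
    let ?B = "interior (grid_square \<delta> c)"
    have "grid_square \<delta> c = closure ?B"
      using \<delta> by (simp add: grid_square_def) (subst closure_box, auto simp: box_ne_empty Basis_complex_def)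
    with c(2) have "z \<in> closure (?T \<inter> ?B)"
      using oT \<open>z \<in> ?T\<close> open_Int_closure_subset[OF oT, of ?B] by auto
    moreover have "continuous_on ?T (\<lambda>z. 2 * pi * \<i> * f z - ?G z)"
    proof (intro continuous_intros)
      show "continuous_on ?T f"
        using holomorphic_on_imp_continuous_on[OF holf] by (rule continuous_on_subset) auto
      fix e assume e: "e \<in> S"
      have "continuous_on (closed_segment (fst e) (snd e)) f"
        using holomorphic_on_imp_continuous_on[OF holf] SK[OF e] by (auto elim: continuous_on_subset)
      from continuous_on_cauchy_transform_linepath[OF this]
      show "continuous_on ?T (\<lambda>z. edge_integral e (\<lambda>w. f w / (w - z)))"
        by (rule continuous_on_subset) (use e in auto)
    qed
    ultimately have "2 * pi * \<i> * f z - ?G z = 0"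
    proof -
      assume cl: "z \<in> closure (?T \<inter> ?B)" and cont: "continuous_on ?T (\<lambda>z. 2 * pi * \<i> * f z - ?G z)"
      have "isCont (\<lambda>z. 2 * pi * \<i> * f z - ?G z) z"
        using cont oT \<open>z \<in> ?T\<close> by (simp add: continuous_on_eq_continuous_at)
      obtain y where y: "\<And>n. y n \<in> ?T \<inter> ?B" "y \<longlonglongrightarrow> z"
        using cl unfolding closure_sequential by blast
      have "(\<lambda>n. 2 * pi * \<i> * f (y n) - ?G (y n)) \<longlonglongrightarrow> 2 * pi * \<i> * f z - ?G z"
        using isCont_tendsto_compose[OF \<open>isCont _ z\<close> y(2)] .
      moreover have "2 * pi * \<i> * f (y n) - ?G (y n) = 0" for n
        using inner[OF cC, of "y n"] y(1)[of n] by simp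
      ultimately show ?thesis by (simp add: LIMSEQ_const_iff)
    qed
    then show ?thesis by simp
  qed
  show ?thesis
    by (rule that[OF _ SK formula]) (simp_all add: S_def finJ)
qed

section \<open>Measures of infinite support on an interval\<close>

locale interval_measure = finite_measure M for M :: "real measure" +
  fixes a b :: real
  assumes sets_M: "sets M = sets borel"
    and infinite_support: "infinite (measure_support M)"
    and support_subset: "measure_support M \<subseteq> {a..b}"
begin

lemma space_M: "space M = UNIV"
  using sets_eq_imp_space_eq[OF sets_M] by simp

lemma measurable_M: "f \<in> borel_measurable borel \<Longrightarrow> f \<in> borel_measurable M"
  by (simp cong: measurable_cong_sets add: sets_M)

text \<open>The complement of the support is covered by open null sets, of which countably many suffice.\<close>

lemma AE_interval: "AE x in M. x \<in> {a..b}"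
proof -
  define F where "F = {U. open U \<and> emeasure M U = 0}"
  obtain F' where F': "F' \<subseteq> F" "countable F'" "\<Union>F' = \<Union>F"
    using Lindelof[of F] by (auto simp: F_def)
  have "\<Union>F' \<in> null_sets M"
  proof (rule null_sets_UN'[of F' "\<lambda>U. U" M, simplified])
    show "U \<in> null_sets M" if "U \<in> F'" for U
      using that F'(1) by (auto simp: F_def null_sets_def sets_M)
  qed (use F' in auto)
  moreover have "{x \<in> space M. x \<notin> {a..b}} \<subseteq> \<Union>F'"
  proof
    fix x assume "x \<in> {x \<in> space M. x \<notin> {a..b}}"
    then have "x \<notin> measure_support M" using support_subset by blast
    then obtain U where "open U" "x \<in> U" "emeasure M U = 0"
      by (auto simp: measure_support_def)
    then show "x \<in> \<Union>F'" unfolding F'(3) F_def by blast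
  qed
  ultimately show ?thesis by (intro AE_I'[of "\<Union>F'"]) auto
qed

lemma integrable_bounded:
  fixes f :: "real \<Rightarrow> 'c :: {banach, second_countable_topology}"
  assumes "f \<in> borel_measurable borel" "\<And>x. x \<in> {a..b} \<Longrightarrow> norm (f x) \<le> B"
  shows "integrable M f"
proof (rule integrable_const_bound)
  show "AE x in M. norm (f x) \<le> B" using AE_interval by eventually_elim (rule assms(2))
qed (rule measurable_M[OF assms(1)])

lemma integrable_continuous:
  fixes f :: "real \<Rightarrow> 'c :: euclidean_space"
  assumes "continuous_on UNIV f"
  shows "integrable M f"
proof -
  have "compact (f ` {a..b})"
    by (intro compact_continuous_image continuous_on_subset[OF assms]) auto
  then obtain B where "\<And>x. x \<in> {a..b} \<Longrightarrow> norm (f x) \<le> B"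
    using compact_imp_bounded bounded_iff by (metis imageI)
  then show ?thesis
    using assms borel_measurable_continuous_onI by (intro integrable_bounded) auto
qed

lemma set_integral_interval:
  fixes f :: "real \<Rightarrow> 'c :: {banach, second_countable_topology}"
  assumes "f \<in> borel_measurable borel"
  shows "(LINT x:{a..b}|M. f x) = (LINT x|M. f x)"
proof -
  have "(\<lambda>x. indicator {a..b} x *\<^sub>R f x) \<in> borel_measurable borel"
    using assms by measurable
  moreover have "AE x in M. indicator {a..b} x *\<^sub>R f x = f x"
    using AE_interval by eventually_elim simp
  ultimately show ?thesis
    unfolding set_lebesgue_integral_def by (intro integral_cong_AE measurable_M assms)
qed

text \<open>This is where the infinite support enters: a nonnegative polynomial whose integral vanishes is zero
  almost everywhere, so that its finitely many roots would contain the support.\<close>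

lemma integral_poly_pos:
  assumes "p \<noteq> 0" and nonneg: "\<And>x. x \<in> {a..b} \<Longrightarrow> poly p x \<ge> 0"
  shows "(LINT x|M. poly p x) > 0"
proof -
  have int: "integrable M (poly p)" by (intro integrable_continuous continuous_intros)
  have ae: "AE x in M. 0 \<le> poly p x" using AE_interval nonneg by auto
  have "(LINT x|M. poly p x) \<noteq> 0"
  proof
    assume "(LINT x|M. poly p x) = 0"
    then have ae0: "AE x in M. x \<in> {x. poly p x = 0}"
      using integral_nonneg_eq_0_iff_AE[OF int ae] by simp
    have opn: "open (- {x. poly p x = 0})"
      using finite_imp_closed[OF poly_roots_finite[OF assms(1)]] by auto
    then have "- {x. poly p x = 0} \<in> sets M" unfolding sets_M by (rule borel_open)
    moreover have "{x \<in> space M. \<not> x \<in> {x. poly p x = 0}} = - {x. poly p x = 0}"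
      by (simp add: space_M Compl_eq)
    ultimately have "(AE x in M. x \<in> {x. poly p x = 0}) \<longleftrightarrow> emeasure M (- {x. poly p x = 0}) = 0"
      by (rule AE_iff_measurable)
    with ae0 have zero: "emeasure M (- {x. poly p x = 0}) = 0" by blast
    have "measure_support M \<subseteq> {x. poly p x = 0}"
    proof
      fix x assume "x \<in> measure_support M"
      then show "x \<in> {x. poly p x = 0}"
        using opn zero unfolding measure_support_def by fastforce
    qed
    then show False
      using infinite_support poly_roots_finite[OF assms(1)] finite_subset by blast
  qed
  moreover have "(LINT x|M. poly p x) \<ge> 0" using ae by (rule integral_nonneg_AE)
  ultimately show ?thesis by simp
qed

lemma set_integrable_continuous:
  fixes f :: "real \<Rightarrow> 'c :: euclidean_space"
  assumes "continuous_on {a..b} f"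
  shows "set_integrable M {a..b} f"
proof -
  have "compact (f ` {a..b})" by (intro compact_continuous_image assms) auto
  then obtain B where B: "\<And>x. x \<in> {a..b} \<Longrightarrow> norm (f x) \<le> B"
    using compact_imp_bounded bounded_iff by (metis imageI)
  have "(\<lambda>x. indicator {a..b} x *\<^sub>R f x) \<in> borel_measurable borel"
    by (intro borel_measurable_continuous_on_indicator assms) auto
  then show ?thesis
    unfolding set_integrable_def by (rule integrable_bounded) (use B in auto)
qed

lemma norm_set_integral_le:
  fixes f :: "real \<Rightarrow> complex"
  assumes "continuous_on {a..b} f" "\<And>x. x \<in> {a..b} \<Longrightarrow> norm (f x) \<le> B" "B \<ge> 0"
  shows "norm (LINT x:{a..b}|M. f x) \<le> B * measure M UNIV"
proof -
  have int: "integrable M (\<lambda>x. indicator {a..b} x *\<^sub>R f x)"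
    using set_integrable_continuous[OF assms(1)] by (simp add: set_integrable_def)
  have "norm (LINT x:{a..b}|M. f x) \<le> (LINT x|M. norm (indicator {a..b} x *\<^sub>R f x))"
    unfolding set_lebesgue_integral_def by (rule integral_norm_bound)
  also have "\<dots> \<le> (LINT x|M. B)"
    using int by (intro integral_mono integrable_norm) (use assms(2,3) in \<open>auto simp: indicator_def\<close>)
  finally show ?thesis by (simp add: space_M mult.commute)
qed

text \<open>Fubini's theorem, with the Henstock--Kurzweil integral that defines contour integrals on one side
  and the Bochner integral on the other.\<close>

lemma integral_set_integral_swap:
  fixes F :: "real \<Rightarrow> real \<Rightarrow> complex"
  assumes cont: "continuous_on ({c..d} \<times> {a..b}) (\<lambda>(t, x). F t x)"
  shows "integral {c..d} (\<lambda>t. LINT x:{a..b}|M. F t x) = (LINT x:{a..b}|M. integral {c..d} (\<lambda>t. F t x))"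
proof -
  note times = emeasure_pair_measure_Times
  interpret pair_sigma_finite lborel M
    by (intro pair_sigma_finite.intro sigma_finite_lborel sigma_finite_measure_axioms)
  define G where "G t x = indicator {c..d} t *\<^sub>R indicator {a..b} x *\<^sub>R F t x" for t x
  have G_eq: "case_prod G = (\<lambda>p. indicator ({c..d} \<times> {a..b}) p *\<^sub>R (case p of (t, x) \<Rightarrow> F t x))"
    by (auto simp: G_def fun_eq_iff indicator_def)
  have sets_eq: "sets (lborel \<Otimes>\<^sub>M M) = sets (borel :: (real \<times> real) measure)"
    using sets_pair_measure_cong[OF sets_lborel sets_M] unfolding borel_prod .
  have "compact ((\<lambda>(t, x). F t x) ` ({c..d} \<times> {a..b}))"
    by (intro compact_continuous_image cont compact_Times) auto
  then obtain B where B: "\<And>t x. t \<in> {c..d} \<Longrightarrow> x \<in> {a..b} \<Longrightarrow> norm (F t x) \<le> B"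
    using compact_imp_bounded bounded_iff by (metis (no_types, lifting) SigmaI case_prod_conv imageI)
  have int: "integrable (lborel \<Otimes>\<^sub>M M) (case_prod G)"
  proof (rule integrableI_bounded_set[where A = "{c..d} \<times> {a..b}" and B = B])
    show "{c..d} \<times> {a..b} \<in> sets (lborel \<Otimes>\<^sub>M M)" by (intro pair_measureI) (auto simp: sets_M)
    have "case_prod G \<in> borel_measurable borel"
      unfolding G_eq by (intro borel_measurable_continuous_on_indicator cont borel_closed closed_Times) auto
    then show "case_prod G \<in> borel_measurable (lborel \<Otimes>\<^sub>M M)"
      using measurable_cong_sets[OF sets_eq refl] by blast
    show "emeasure (lborel \<Otimes>\<^sub>M M) ({c..d} \<times> {a..b}) < \<infinity>"
      by (subst times)
         (auto simp: sets_M ennreal_mult_eq_top_iff emeasure_lborel_Icc_eq less_top[symmetric])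
    show "AE p in lborel \<Otimes>\<^sub>M M. p \<in> {c..d} \<times> {a..b} \<longrightarrow> norm (case_prod G p) \<le> B"
      using B by (intro AE_I2) (auto simp: G_def)
    show "AE p in lborel \<Otimes>\<^sub>M M. p \<notin> {c..d} \<times> {a..b} \<longrightarrow> case_prod G p = 0"
      unfolding G_eq by (intro AE_I2) simp
  qed
  have inner: "(LINT t|lborel. G t x) = indicator {a..b} x *\<^sub>R integral {c..d} (\<lambda>t. F t x)" for x
  proof (cases "x \<in> {a..b}")
    case True
    have "continuous_on {c..d} (\<lambda>t. (\<lambda>(t, x). F t x) (t, x))"
      by (rule continuous_on_compose2[OF cont]) (use True in \<open>auto intro!: continuous_intros\<close>)
    then have "set_integrable lborel {c..d} (\<lambda>t. F t x)"
      by (intro borel_integrable_atLeastAtMost') simp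
    from set_borel_integral_eq_integral(2)[OF this] True show ?thesis
      by (simp add: G_def set_lebesgue_integral_def)
  qed (simp add: G_def)
  have outer: "(LINT x|M. G t x) = indicator {c..d} t *\<^sub>R (LINT x:{a..b}|M. F t x)" for t
    by (cases "t \<in> {c..d}") (simp_all add: G_def set_lebesgue_integral_def)
  have "set_integrable lborel {c..d} (\<lambda>t. LINT x:{a..b}|M. F t x)"
    using integrable_fst[OF int] by (simp add: outer set_integrable_def)
  from set_borel_integral_eq_integral(2)[OF this]
  have "integral {c..d} (\<lambda>t. LINT x:{a..b}|M. F t x) = (LINT t|lborel. LINT x|M. G t x)"
    by (simp add: outer set_lebesgue_integral_def)
  also have "\<dots> = (LINT x|M. LINT t|lborel. G t x)" by (rule Fubini_integral[OF int, symmetric])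
  finally show ?thesis by (simp add: inner set_lebesgue_integral_def)
qed

lemma contour_integral_markov_function:
  assumes contf: "continuous_on (closed_segment p q) f"
    and disj: "closed_segment p q \<inter> of_real ` {a..b} = {}"
  shows "contour_integral (linepath p q) (\<lambda>z. f z * markov_function M a b z)
           = (LINT x:{a..b}|M. contour_integral (linepath p q) (\<lambda>z. f z / (z - of_real x)))"
proof -
  let ?l = "linepath p q"
  define F where "F t x = f (?l t) * (q - p) / (?l t - of_real x)" for t x
  have mem: "?l t \<in> closed_segment p q" if "t \<in> {0..1}" for t
    using that linepath_in_path by blast
  have contl: "continuous_on ({0..1} \<times> {a..b}) (\<lambda>p. f (?l (fst p)))"
    by (rule continuous_on_compose2[OF contf])
       (use mem in \<open>auto simp: linepath_def intro!: continuous_intros\<close>)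
  have nz: "?l t - of_real x \<noteq> 0" if "t \<in> {0..1}" "x \<in> {a..b}" for t x
    using mem[OF that(1)] disj that(2) by auto
  have cont: "continuous_on ({0..1} \<times> {a..b}) (\<lambda>(t, x). F t x)"
    unfolding F_def case_prod_unfold
    by (intro continuous_intros contl) (use nz in \<open>auto simp: linepath_def intro!: continuous_intros\<close>)
  have "contour_integral ?l (\<lambda>z. f z * markov_function M a b z)
          = integral {0..1} (\<lambda>t. LINT x:{a..b}|M. F t x)"
    unfolding contour_integral_integral
  proof (rule integral_cong)
    fix t :: real
    have "f (?l t) * markov_function M a b (?l t) * vector_derivative ?l (at t)
            = (f (?l t) * (q - p)) * (LINT x:{a..b}|M. 1 / (?l t - of_real x))"
      by (simp add: markov_function_def)
    also have "\<dots> = (LINT x:{a..b}|M. F t x)"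
      unfolding F_def by (subst set_integral_mult_right[symmetric]) simp
    finally show "f (?l t) * markov_function M a b (?l t) * vector_derivative ?l (at t)
            = (LINT x:{a..b}|M. F t x)" .
  qed
  also have "\<dots> = (LINT x:{a..b}|M. integral {0..1} (\<lambda>t. F t x))"
    by (rule integral_set_integral_swap[OF cont])
  also have "\<dots> = (LINT x:{a..b}|M. contour_integral ?l (\<lambda>z. f z / (z - of_real x)))"
    by (simp add: contour_integral_integral F_def)
  finally show ?thesis .
qed

end

section \<open>Polynomials and linear systems\<close>

text \<open>The intended \<open>Z\<close> is the set of roots in the open interval that have odd order. An induction on the
  degree produces it without any mention of orders: when a root \<open>c\<close> is split off as \<open>p = (x - c) q\<close>,
  its membership in the set for \<open>q\<close> is toggled, since \<open>(x - c)\<close> then either moves from one factor to the other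
  or appears squared.\<close>

lemma poly_sign_after_cancelling_roots:
  fixes p :: "real poly"
  assumes "p \<noteq> 0"
  shows "\<exists>Z s. finite Z \<and> Z \<subseteq> {a<..<b} \<and> (\<forall>z\<in>Z. poly p z = 0) \<and> s \<noteq> 0 \<and>
           (\<forall>x\<in>{a..b}. s * poly (p * (\<Prod>z\<in>Z. [:- z, 1:])) x \<ge> 0)"
  using assms
proof (induction "degree p" arbitrary: p rule: less_induct)
  case less
  let ?pr = "\<lambda>Z. \<Prod>z\<in>Z. [:- z, 1::real:]"
  show ?case
  proof (cases "\<exists>c\<in>{a<..<b}. poly p c = 0")
    case False
    have "\<exists>s. s \<noteq> 0 \<and> (\<forall>x\<in>{a..b}. s * poly p x \<ge> 0)"
    proof (rule ccontr)
      assume "\<not> ?thesis"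
      then have neg: "\<exists>x\<in>{a..b}. s * poly p x < 0" if "s \<noteq> 0" for s
        using that not_le by blast
      obtain x where x: "x \<in> {a..b}" "poly p x < 0" using neg[of 1] by auto
      obtain y where y: "y \<in> {a..b}" "poly p y > 0" using neg[of "-1"] by auto
      note xy = x(1) y(1) x(2) y(2)
      then have "x \<noteq> y" by auto
      then consider "x < y" | "y < x" by linarith
      then obtain c where "min x y < c" "c < max x y" "poly p c = 0"
      proof cases
        case 1
        with poly_IVT_pos[OF 1 xy(3,4)] that show thesis by auto
      next
        case 2
        with poly_IVT_neg[OF 2 xy(4,3)] that show thesis by auto
      qed
      with False xy(1,2) show False by (auto simp: min_def max_def split: if_splits)
    qed
    then obtain s where "s \<noteq> 0" "\<forall>x\<in>{a..b}. s * poly p x \<ge> 0" by blast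
    then show ?thesis by (intro exI[of _ "{}"] exI[of _ s]) simp
  next
    case True
    then obtain c q where c: "c \<in> {a<..<b}" and p: "p = [:- c, 1:] * q"
      unfolding poly_eq_0_iff_dvd dvd_def by blast
    with less.prems have "q \<noteq> 0" by auto
    have "degree q < degree p"
      unfolding p using \<open>q \<noteq> 0\<close> by (subst degree_mult_eq) auto
    from less.hyps[OF this \<open>q \<noteq> 0\<close>] obtain Z s
      where Z: "finite Z" "Z \<subseteq> {a<..<b}" "\<forall>z\<in>Z. poly q z = 0" "s \<noteq> 0"
        "\<forall>x\<in>{a..b}. s * poly (q * ?pr Z) x \<ge> 0"
      by blast
    show ?thesis
    proof (cases "c \<in> Z")
      case True
      then have "?pr Z = [:- c, 1:] * ?pr (Z - {c})"
        using Z(1) by (simp add: prod.remove)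
      then have eq: "q * ?pr Z = p * ?pr (Z - {c})" unfolding p by (simp only: mult_ac)
      show ?thesis
        using Z by (intro exI[of _ "Z - {c}"] exI[of _ s]) (auto simp: p eq[unfolded p])
    next
      case False
      then have "?pr (insert c Z) = [:- c, 1:] * ?pr Z" using Z(1) by simp
      then have eq: "p * ?pr (insert c Z) = [:- c, 1:] ^ 2 * (q * ?pr Z)"
        unfolding p power2_eq_square by (simp only: mult_ac)
      have square: "s * poly (p * ?pr (insert c Z)) x = (x - c) ^ 2 * (s * poly (q * ?pr Z) x)" for x
        unfolding eq by simp
      have "\<forall>x\<in>{a..b}. s * poly (p * ?pr (insert c Z)) x \<ge> 0"
        unfolding square using Z(5) by (intro ballI mult_nonneg_nonneg[OF zero_le_power2]) blast
      moreover have "\<forall>z\<in>insert c Z. poly p z = 0" using Z(3) by (simp add: p)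
      ultimately show ?thesis
        using Z(1,2,4) c by (intro exI[of _ "insert c Z"] exI[of _ s]) (auto simp del: poly_mult)
    qed
  qed
qed

text \<open>Gaussian elimination: one equation is solved for a variable \<open>k\<close> with nonzero coefficient, and this
  variable is eliminated from the others.\<close>

lemma underdetermined_system_solution:
  fixes A :: "nat \<Rightarrow> 'j \<Rightarrow> 'a :: field"
  assumes "finite J" "m < card J"
  obtains c where "\<exists>j\<in>J. c j \<noteq> 0" "\<And>i. i < m \<Longrightarrow> (\<Sum>j\<in>J. A i j * c j) = 0"
proof -
  have "\<exists>c. (\<exists>j\<in>J. c j \<noteq> 0) \<and> (\<forall>i<m. (\<Sum>j\<in>J. A i j * c j) = 0)"
    using assms
  proof (induction m arbitrary: J A)
    case 0
    then have "J \<noteq> {}" by auto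
    then show ?case by (intro exI[of _ "\<lambda>_. 1"]) auto
  next
    case (Suc m)
    show ?case
    proof (cases "\<exists>k\<in>J. A m k \<noteq> 0")
      case False
      obtain c where "\<exists>j\<in>J. c j \<noteq> 0" "\<forall>i<m. (\<Sum>j\<in>J. A i j * c j) = 0"
        using Suc.IH[of J A] Suc.prems by auto
      with False show ?thesis by (intro exI[of _ c]) (auto simp: less_Suc_eq)
    next
      case True
      then obtain k where k: "k \<in> J" "A m k \<noteq> 0" by blast
      let ?J = "J - {k}"
      have J: "finite ?J" "m < card ?J" using Suc.prems k(1) by auto
      obtain c where c: "\<exists>j\<in>?J. c j \<noteq> 0"
        "\<And>i. i < m \<Longrightarrow> (\<Sum>j\<in>?J. (A i j - A i k / A m k * A m j) * c j) = 0"
        using Suc.IH[OF J, of "\<lambda>i j. A i j - A i k / A m k * A m j"] by blast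
      define s where "s = (\<Sum>j\<in>?J. A m j * c j)"
      let ?c = "c(k := - s / A m k)"
      have split: "(\<Sum>j\<in>J. A i j * ?c j) = - (A i k / A m k) * s + (\<Sum>j\<in>?J. A i j * c j)" for i
        using Suc.prems(1) k(1) by (subst sum.remove[of _ k]) auto
      have "(\<Sum>j\<in>J. A i j * ?c j) = 0" if "i < Suc m" for i
      proof (cases "i = m")
        case True
        with k(2) show ?thesis unfolding split by (simp add: s_def)
      next
        case False
        with that c(2)[of i] have "(\<Sum>j\<in>?J. A i j * c j) - A i k / A m k * s = 0"
          by (simp add: s_def left_diff_distrib sum_subtractf sum_distrib_left mult.assoc)
        then show ?thesis unfolding split by simp
      qed
      with c(1) show ?thesis by (intro exI[of _ ?c]) auto
    qed
  qed
  then show ?thesis using that by blast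
qed

lemma poly_eqI_agree:
  fixes p q :: "'a :: idom poly"
  assumes "finite A" "degree (p - q) < card A" "\<And>x. x \<in> A \<Longrightarrow> poly p x = poly q x"
  shows "p = q"
proof (rule ccontr)
  assume "p \<noteq> q"
  then have nz: "p - q \<noteq> 0" by simp
  have "card A \<le> card {x. poly (p - q) x = 0}"
    using poly_roots_finite[OF nz] assms(3) by (intro card_mono) auto
  also have "\<dots> \<le> degree (p - q)" by (rule card_poly_roots_bound[OF nz])
  finally show False using assms(2) by simp
qed

lemma poly_map_poly_of_real:
  "poly (map_poly complex_of_real p) (of_real y) = of_real (poly p y)"
  by (induction p) (auto simp: map_poly_pCons)

section \<open>Diagonal multiple orthogonal polynomials\<close>

text \<open>If there were fewer than \<open>n\<close> sign changes, then the product of \<open>p\<close> with the polynomial \<open>q\<close> that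
  vanishes at the sign changes would have constant sign, while orthogonality makes its integral zero.\<close>

lemma (in interval_measure) orthogonal_poly_roots:
  assumes "p \<noteq> 0" and orth: "\<And>k. k < n \<Longrightarrow> (LINT x|M. poly p x * x ^ k) = 0"
  obtains Z where "finite Z" "Z \<subseteq> {a<..<b}" "\<And>z. z \<in> Z \<Longrightarrow> poly p z = 0" "n \<le> card Z"
proof -
  obtain Z s where Z: "finite Z" "Z \<subseteq> {a<..<b}" "\<forall>z\<in>Z. poly p z = 0" "s \<noteq> 0"
    "\<forall>x\<in>{a..b}. s * poly (p * (\<Prod>z\<in>Z. [:- z, 1:])) x \<ge> 0"
    using poly_sign_after_cancelling_roots[OF assms(1), of a b] by blast
  define q where "q = (\<Prod>z\<in>Z. [:- z, 1:])"
  have "q \<noteq> 0" using Z(1) by (simp add: q_def)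
  have deg: "degree q = card Z"
    unfolding q_def using Z(1) by (subst degree_prod_sum_eq) auto
  have "n \<le> card Z"
  proof (rule ccontr)
    assume "\<not> n \<le> card Z"
    have "(LINT x|M. poly (p * q) x) = (LINT x|M. (\<Sum>i\<le>degree q. coeff q i * (poly p x * x ^ i)))"
      by (simp add: poly_altdef[of q] sum_distrib_left mult_ac)
    also have "\<dots> = (\<Sum>i\<le>degree q. coeff q i * (LINT x|M. poly p x * x ^ i))"
      by (subst Bochner_Integration.integral_sum)
         (auto intro!: integrable_continuous continuous_intros)
    also have "\<dots> = 0"
      using orth \<open>\<not> n \<le> card Z\<close> deg by (intro sum.neutral) auto
    finally have "(LINT x|M. poly (smult s (p * q)) x) = 0" by simp
    moreover have "(LINT x|M. poly (smult s (p * q)) x) > 0"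
    proof (rule integral_poly_pos)
      show "smult s (p * q) \<noteq> 0" using assms(1) \<open>q \<noteq> 0\<close> Z(4) by simp
      show "poly (smult s (p * q)) x \<ge> 0" if "x \<in> {a..b}" for x
        using Z(5) that unfolding q_def poly_smult by blast
    qed
    ultimately show False by force
  qed
  with Z(1-3) show ?thesis by (intro that[of Z]) simp_all
qed

locale angelesco = \<mu>1: interval_measure \<mu>1 a1 b1 + \<mu>2: interval_measure \<mu>2 a2 b2
  for \<mu>1 \<mu>2 :: "real measure" and a1 b1 a2 b2 :: real +
  assumes a1_less_b1: "a1 < b1" and b1_le_a2: "b1 \<le> a2" and a2_less_b2: "a2 < b2"
begin

definition multiple_orthogonal :: "nat \<Rightarrow> real poly \<Rightarrow> bool" where
  "multiple_orthogonal n p \<longleftrightarrow>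
     (\<forall>k<n. (LINT x|\<mu>1. poly p x * x ^ k) = 0 \<and> (LINT x|\<mu>2. poly p x * x ^ k) = 0)"

text \<open>Each measure contributes \<open>n\<close> roots, in disjoint intervals. When the degree is \<open>2n\<close>, these are all roots.\<close>

lemma multiple_orthogonal_roots:
  assumes "p \<noteq> 0" "multiple_orthogonal n p"
  shows "2 * n \<le> degree p"
    and "degree p = 2 * n \<Longrightarrow> card {x. poly p x = 0} = 2 * n"
    and "degree p = 2 * n \<Longrightarrow> {x. poly p x = 0} \<subseteq> {a1<..<b1} \<union> {a2<..<b2}"
proof -
  obtain Z1 where Z1: "finite Z1" "Z1 \<subseteq> {a1<..<b1}" "\<And>z. z \<in> Z1 \<Longrightarrow> poly p z = 0" "n \<le> card Z1"
    using \<mu>1.orthogonal_poly_roots[OF assms(1), of n] assms(2) by (auto simp: multiple_orthogonal_def)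
  obtain Z2 where Z2: "finite Z2" "Z2 \<subseteq> {a2<..<b2}" "\<And>z. z \<in> Z2 \<Longrightarrow> poly p z = 0" "n \<le> card Z2"
    using \<mu>2.orthogonal_poly_roots[OF assms(1), of n] assms(2) by (auto simp: multiple_orthogonal_def)
  have "Z1 \<inter> Z2 = {}" using Z1(2) Z2(2) b1_le_a2 by force
  then have card: "2 * n \<le> card (Z1 \<union> Z2)"
    using Z1 Z2 by (simp add: card_Un_disjoint)
  have sub: "Z1 \<union> Z2 \<subseteq> {x. poly p x = 0}" using Z1(3) Z2(3) by auto
  have fin: "finite {x. poly p x = 0}" by (rule poly_roots_finite[OF assms(1)])
  have le: "card (Z1 \<union> Z2) \<le> card {x. poly p x = 0}" using sub fin by (rule card_mono[rotated])
  have bound: "card {x. poly p x = 0} \<le> degree p" by (rule card_poly_roots_bound[OF assms(1)])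
  from card le bound show "2 * n \<le> degree p" by linarith
  assume deg: "degree p = 2 * n"
  from card le bound deg show "card {x. poly p x = 0} = 2 * n" by linarith
  have "Z1 \<union> Z2 = {x. poly p x = 0}"
    using sub fin card le bound deg by (intro card_subset_eq) auto
  with Z1(2) Z2(2) show "{x. poly p x = 0} \<subseteq> {a1<..<b1} \<union> {a2<..<b2}" by blast
qed

lemma multiple_orthogonal_smult:
  "multiple_orthogonal n p \<Longrightarrow> multiple_orthogonal n (smult c p)"
  by (simp add: multiple_orthogonal_def mult.assoc)

lemma multiple_orthogonal_diff:
  assumes "multiple_orthogonal n p" "multiple_orthogonal n q"
  shows "multiple_orthogonal n (p - q)"
proof -
  have "integrable \<mu>1 (\<lambda>x. poly p x * x ^ k)" "integrable \<mu>2 (\<lambda>x. poly p x * x ^ k)" for p k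
    by (auto intro!: \<mu>1.integrable_continuous \<mu>2.integrable_continuous continuous_intros)
  then show ?thesis
    using assms by (simp add: multiple_orthogonal_def left_diff_distrib)
qed

text \<open>The \<open>2n\<close> conditions are numbered so that those for \<open>\<mu>1\<close> come first; they are linear in the \<open>2n + 1\<close>
  coefficients of \<open>p\<close>.\<close>

lemma multiple_orthogonal_exists:
  obtains p where "p \<noteq> 0" "degree p \<le> 2 * n" "multiple_orthogonal n p"
proof -
  define A where "A i j = (if i < n then LINT x|\<mu>1. x ^ j * x ^ i else LINT x|\<mu>2. x ^ j * x ^ (i - n))"
    for i j :: nat
  obtain c where c: "\<exists>j\<in>{..2 * n}. c j \<noteq> 0" "\<And>i. i < 2 * n \<Longrightarrow> (\<Sum>j\<le>2 * n. A i j * c j) = 0"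
    by (rule underdetermined_system_solution[of "{..2 * n}" "2 * n" A]) auto
  define p where "p = (\<Sum>j\<le>2 * n. monom (c j) j)"
  have coeff: "coeff p j = (if j \<le> 2 * n then c j else 0)" for j
    by (simp add: p_def coeff_sum)
  have poly: "poly p x * x ^ k = (\<Sum>j\<le>2 * n. (x ^ j * x ^ k) * c j)" for x k
    unfolding p_def poly_sum poly_monom sum_distrib_right by (intro sum.cong refl) (simp only: mult_ac)
  have i1: "(LINT x|\<mu>1. poly p x * x ^ k) = (\<Sum>j\<le>2 * n. (LINT x|\<mu>1. x ^ j * x ^ k) * c j)" for k
    unfolding poly
    by (subst Bochner_Integration.integral_sum)
       (auto intro!: \<mu>1.integrable_continuous continuous_intros)
  have i2: "(LINT x|\<mu>2. poly p x * x ^ k) = (\<Sum>j\<le>2 * n. (LINT x|\<mu>2. x ^ j * x ^ k) * c j)" for k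
    unfolding poly
    by (subst Bochner_Integration.integral_sum)
       (auto intro!: \<mu>2.integrable_continuous continuous_intros)
  have "multiple_orthogonal n p"
    unfolding multiple_orthogonal_def i1 i2
  proof (intro allI impI conjI)
    fix k assume "k < n"
    with c(2)[of k] show "(\<Sum>j\<le>2 * n. (LINT x|\<mu>1. x ^ j * x ^ k) * c j) = 0" by (simp add: A_def)
    from \<open>k < n\<close> c(2)[of "n + k"] show "(\<Sum>j\<le>2 * n. (LINT x|\<mu>2. x ^ j * x ^ k) * c j) = 0"
      by (simp add: A_def)
  qed
  moreover have "p \<noteq> 0"
  proof -
    obtain j where "j \<le> 2 * n" "c j \<noteq> 0" using c(1) by auto
    then have "coeff p j \<noteq> 0" by (simp add: coeff)
    then show ?thesis by auto
  qed
  moreover have "degree p \<le> 2 * n" by (rule degree_le) (simp add: coeff)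
  ultimately show ?thesis using that by blast
qed

text \<open>The difference of two monic solutions would be a solution of degree below \<open>2n\<close>, hence zero. This
  yields uniqueness, so the definite description denotes the intended polynomial.\<close>

lemma mop_diag:
  shows "degree (mop_diag \<mu>1 \<mu>2 n) = 2 * n" "lead_coeff (mop_diag \<mu>1 \<mu>2 n) = 1"
    "multiple_orthogonal n (mop_diag \<mu>1 \<mu>2 n)"
proof -
  let ?Q = "\<lambda>p. degree p = 2 * n \<and> lead_coeff p = 1 \<and> multiple_orthogonal n p"
  have "\<exists>!p. ?Q p"
  proof (rule ex_ex1I)
    obtain p where p: "p \<noteq> 0" "degree p \<le> 2 * n" "multiple_orthogonal n p"
      by (rule multiple_orthogonal_exists)
    with multiple_orthogonal_roots(1)[of p n] have "degree p = 2 * n" by simp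
    moreover have "lead_coeff p \<noteq> 0" using p(1) by simp
    ultimately show "\<exists>p. ?Q p" using p(3)
      by (intro exI[of _ "smult (1 / lead_coeff p) p"])
         (auto intro: multiple_orthogonal_smult simp del: leading_coeff_0_iff)
  next
    fix p q assume pq: "?Q p" "?Q q"
    show "p = q"
    proof (rule ccontr)
      assume "p \<noteq> q"
      then have "p - q \<noteq> 0" by simp
      from multiple_orthogonal_roots(1)[OF this] pq have "2 * n \<le> degree (p - q)"
        by (auto intro: multiple_orthogonal_diff)
      moreover have "coeff (p - q) (2 * n) = 0" using pq by auto
      moreover have "degree (p - q) \<le> 2 * n" using pq by (intro degree_diff_le) auto
      ultimately have "lead_coeff (p - q) = 0" by (metis le_antisym)
      with \<open>p - q \<noteq> 0\<close> show False by (simp only: leading_coeff_0_iff)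
    qed
  qed
  from theI'[OF this] have "?Q (mop_diag \<mu>1 \<mu>2 n)"
    unfolding mop_diag_def multiple_orthogonal_def .
  then show "degree (mop_diag \<mu>1 \<mu>2 n) = 2 * n" "lead_coeff (mop_diag \<mu>1 \<mu>2 n) = 1"
    "multiple_orthogonal n (mop_diag \<mu>1 \<mu>2 n)" by blast+
qed

lemma mop_diag_nonzero: "mop_diag \<mu>1 \<mu>2 n \<noteq> 0"
  using mop_diag(2)[of n] by auto

lemma bij_betw_node: "bij_betw (node \<mu>1 \<mu>2 n) {1..2 * n} {x. poly (mop_diag \<mu>1 \<mu>2 n) x = 0}"
proof -
  let ?X = "{x. poly (mop_diag \<mu>1 \<mu>2 n) x = 0}"
  have fin: "finite ?X" by (rule poly_roots_finite[OF mop_diag_nonzero])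
  have card: "card ?X = 2 * n"
    by (rule multiple_orthogonal_roots(2)[OF mop_diag_nonzero mop_diag(3) mop_diag(1)])
  have "bij_betw (\<lambda>k. k - 1) {1..2 * n} {..<2 * n}"
    by (rule bij_betw_byWitness[of _ Suc]) auto
  moreover have "bij_betw ((!) (sorted_list_of_set ?X)) {..<2 * n} ?X"
    using fin card by (intro bij_betw_nth) auto
  ultimately have "bij_betw ((!) (sorted_list_of_set ?X) \<circ> (\<lambda>k. k - 1)) {1..2 * n} ?X"
    by (rule bij_betw_trans)
  then show ?thesis by (simp add: node_def[abs_def] comp_def)
qed

lemma node_mem: "j \<in> {1..2 * n} \<Longrightarrow> node \<mu>1 \<mu>2 n j \<in> {a1<..<b1} \<union> {a2<..<b2}"
  using subsetD[OF multiple_orthogonal_roots(3)[OF mop_diag_nonzero mop_diag(3) mop_diag(1)]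
      bij_betw_apply[OF bij_betw_node]] .

section \<open>Interpolatory quadrature and the Hermite--Pade error\<close>

lemma inj_on_node: "inj_on (node \<mu>1 \<mu>2 n) {1..2 * n}"
  using bij_betw_node by (rule bij_betw_imp_inj_on)

lemma fundamental_poly:
  assumes "n > 0" "k \<in> {1..2 * n}"
  shows "degree (fundamental_poly \<mu>1 \<mu>2 n k) \<le> 2 * n - 1"
    and "\<And>i. i \<in> {1..2 * n} \<Longrightarrow>
           poly (fundamental_poly \<mu>1 \<mu>2 n k) (node \<mu>1 \<mu>2 n i) = (if i = k then 1 else 0)"
proof -
  let ?I = "{1..2 * n}" and ?x = "node \<mu>1 \<mu>2 n"
  let ?Q = "\<lambda>l. degree l \<le> 2 * n - 1 \<and> (\<forall>i\<in>?I. poly l (?x i) = (if i = k then 1 else 0))"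
  have "\<exists>!l. ?Q l"
  proof (rule ex_ex1I)
    define l where "l = (\<Prod>i\<in>?I - {k}. smult (1 / (?x k - ?x i)) [:- ?x i, 1:])"
    have "degree (smult c [:- y, 1:]) \<le> 1" for c y :: real
      by (rule order.trans[OF degree_smult_le]) simp
    then have "degree l \<le> (\<Sum>i\<in>?I - {k}. 1)"
      unfolding l_def by (intro order.trans[OF degree_prod_sum_le] sum_mono) (simp_all only: comp_def finite_Diff finite_atLeastAtMost)
    also have "\<dots> = 2 * n - 1" using assms(2) by (simp add: card_Diff_singleton)
    finally have "degree l \<le> 2 * n - 1" .
    moreover have "poly l (?x i) = (if i = k then 1 else 0)" if i: "i \<in> ?I" for i
    proof (cases "i = k")
      case True
      have "poly (smult (1 / (?x k - ?x j)) [:- ?x j, 1:]) (?x k) = 1" if "j \<in> ?I - {k}" for j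
      proof -
        have "?x k - ?x j \<noteq> 0" using that assms(2) inj_onD[OF inj_on_node, of n k j] by auto
        then show ?thesis by (simp add: diff_divide_distrib[symmetric])
      qed
      then have "poly l (?x k) = (\<Prod>j\<in>?I - {k}. 1)"
        unfolding l_def poly_prod by (intro prod.cong refl)
      with True show ?thesis by simp
    next
      case False
      with i have "poly l (?x i) = 0"
        unfolding l_def poly_prod by (intro prod_zero bexI[of _ i]) auto
      with False show ?thesis by simp
    qed
    ultimately show "\<exists>l. ?Q l" by blast
  next
    fix l m assume lm: "?Q l" "?Q m"
    show "l = m"
    proof (rule poly_eqI_agree[where A = "?x ` ?I"])
      have "degree (l - m) \<le> 2 * n - 1" using lm by (intro degree_diff_le) auto
      with assms(1) show "degree (l - m) < card (?x ` ?I)"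
        using card_image[OF inj_on_node, of n] by simp
    qed (use lm in auto)
  qed
  from theI'[OF this] have *: "?Q (fundamental_poly \<mu>1 \<mu>2 n k)"
    unfolding fundamental_poly_def .
  from * show "degree (fundamental_poly \<mu>1 \<mu>2 n k) \<le> 2 * n - 1" by blast
  from * show "\<And>i. i \<in> ?I \<Longrightarrow> poly (fundamental_poly \<mu>1 \<mu>2 n k) (?x i) = (if i = k then 1 else 0)"
    by blast
qed

lemma lagrange_interpolation:
  fixes q :: "complex poly"
  assumes "degree q < 2 * n"
  shows "poly q (of_real x) = (\<Sum>j = 1..2 * n. of_real (poly (fundamental_poly \<mu>1 \<mu>2 n j) x)
                                    * poly q (of_real (node \<mu>1 \<mu>2 n j)))"
proof -
  let ?I = "{1..2 * n}" and ?x = "node \<mu>1 \<mu>2 n"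
  let ?l = "\<lambda>j. map_poly complex_of_real (fundamental_poly \<mu>1 \<mu>2 n j)"
  let ?L = "\<Sum>j\<in>?I. smult (poly q (of_real (?x j))) (?l j)"
  have n: "n > 0" using assms by simp
  have poly_l: "poly (?l j) (of_real y) = of_real (poly (fundamental_poly \<mu>1 \<mu>2 n j) y)" for j y
    by (rule poly_map_poly_of_real)
  have "q = ?L"
  proof (rule poly_eqI_agree[where A = "of_real ` ?x ` ?I"])
    have "degree (smult (poly q (of_real (?x j))) (?l j)) \<le> 2 * n - 1" if "j \<in> ?I" for j
      using fundamental_poly(1)[OF n that] degree_smult_le[of "poly q (of_real (?x j))" "?l j"]
      by (simp add: degree_map_poly)
    then have "degree ?L \<le> 2 * n - 1" by (intro degree_sum_le) auto
    then have "degree (q - ?L) \<le> 2 * n - 1" using assms by (intro degree_diff_le) auto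
    moreover have "inj_on complex_of_real (?x ` ?I)" by (auto simp: inj_on_def)
    then have "card (complex_of_real ` ?x ` ?I) = 2 * n"
      using card_image[OF inj_on_node, of n] by (simp add: card_image)
    ultimately show "degree (q - ?L) < card (complex_of_real ` ?x ` ?I)" using n by linarith
  next
    fix y assume "y \<in> complex_of_real ` ?x ` ?I"
    then obtain i where i: "i \<in> ?I" "y = of_real (?x i)" by blast
    have "poly ?L y = (\<Sum>j\<in>?I. poly q (of_real (?x j)) * (if i = j then 1 else 0))"
      unfolding poly_sum using i fundamental_poly(2)[OF n]
      by (intro sum.cong) (auto simp: poly_l)
    also have "\<dots> = poly q y" using i by (simp add: if_distrib sum.delta cong: if_cong)
    finally show "poly q y = poly ?L y" ..
  qed simp
  then have "poly q (of_real x) = poly ?L (of_real x)" by (rule arg_cong)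
  then show ?thesis by (simp add: poly_sum poly_l mult.commute)
qed

text \<open>Polynomials with complex coefficients are needed because the result is applied to divided
  differences at a complex point \<open>z\<close>.\<close>

lemma quadrature_exact:
  fixes q :: "complex poly"
  assumes "interval_measure \<nu> a b" "degree q < 2 * n"
  shows "(\<Sum>j = 1..2 * n. of_real (quad_weight \<mu>1 \<mu>2 \<nu> n j) * poly q (of_real (node \<mu>1 \<mu>2 n j)))
           = (LINT x|\<nu>. poly q (of_real x))"
proof -
  interpret interval_measure \<nu> a b by fact
  let ?l = "fundamental_poly \<mu>1 \<mu>2 n"
  have int: "integrable \<nu> (\<lambda>x. complex_of_real (poly (?l j) x) * c)" for j c
    by (intro integrable_continuous continuous_intros)
  have "(LINT x|\<nu>. poly q (of_real x))
      = (LINT x|\<nu>. (\<Sum>j = 1..2 * n. of_real (poly (?l j) x) * poly q (of_real (node \<mu>1 \<mu>2 n j))))"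
    by (intro Bochner_Integration.integral_cong refl lagrange_interpolation[OF assms(2)])
  also have "\<dots> = (\<Sum>j = 1..2 * n. (LINT x|\<nu>. of_real (poly (?l j) x) * poly q (of_real (node \<mu>1 \<mu>2 n j))))"
    by (rule Bochner_Integration.integral_sum) (rule int)
  also have "\<dots> = (\<Sum>j = 1..2 * n. of_real (quad_weight \<mu>1 \<mu>2 \<nu> n j) * poly q (of_real (node \<mu>1 \<mu>2 n j)))"
    by (simp add: quad_weight_def)
  finally show ?thesis ..
qed

definition node_poly :: "nat \<Rightarrow> complex poly" where
  "node_poly n = (\<Prod>j\<in>{1..2 * n}. [:- of_real (node \<mu>1 \<mu>2 n j), 1:])"

lemma degree_node_poly: "degree (node_poly n) = 2 * n"
  unfolding node_poly_def by (subst degree_prod_sum_eq) auto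

lemma poly_node_poly: "poly (node_poly n) z = (\<Prod>j\<in>{1..2 * n}. z - of_real (node \<mu>1 \<mu>2 n j))"
  by (simp add: node_poly_def poly_prod)

text \<open>With \<open>P\<close> the node polynomial, the divided difference \<open>q(x) = (P(z) - P(x)) / (z - x)\<close> is a
  polynomial in \<open>x\<close> of degree below \<open>2n\<close>. It is integrated exactly, and at the nodes it equals
  \<open>P(z) / (z - x\<^sub>j)\<close>, so that its quadrature sum is \<open>P(z)\<close> times the approximant.\<close>

lemma hp_approx_error:
  assumes \<nu>: "interval_measure \<nu> a b" and sub: "{a..b} \<subseteq> {a1..b2}" and "n > 0"
    and z: "z \<notin> of_real ` {a1..b2}"
  shows "hp_approx \<mu>1 \<mu>2 \<nu> n z - markov_function \<nu> a b z
           = - (LINT x:{a..b}|\<nu>. poly (node_poly n) (of_real x) / (z - of_real x)) / poly (node_poly n) z"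
proof -
  interpret interval_measure \<nu> a b by fact
  let ?P = "poly (node_poly n)" and ?x = "node \<mu>1 \<mu>2 n"
  have node_z: "z \<noteq> of_real (?x j)" if "j \<in> {1..2 * n}" for j
    using node_mem[OF that] z a1_less_b1 b1_le_a2 a2_less_b2 by auto
  have Pz: "?P z \<noteq> 0" using node_z by (simp add: poly_node_poly)
  have Pnode: "?P (of_real (?x j)) = 0" if "j \<in> {1..2 * n}" for j
    using that by (auto simp: poly_node_poly)
  have "[:- z, 1:] dvd (node_poly n - [:?P z:])" by (simp add: poly_eq_0_iff_dvd[symmetric])
  then obtain q where q: "node_poly n - [:?P z:] = [:- z, 1:] * q" by (rule dvdE)
  have q_eq: "poly q w = ?P z * (1 / (z - w)) - ?P w / (z - w)" if "w \<noteq> z" for w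
  proof -
    have "?P z - ?P w = (z - w) * poly q w"
      using arg_cong[OF q, of "\<lambda>p. poly p w"] by (simp add: algebra_simps)
    with that have "poly q w = (?P z - ?P w) / (z - w)" by simp
    then show ?thesis by (simp add: diff_divide_distrib)
  qed
  have "degree q < 2 * n"
  proof (cases "q = 0")
    case False
    then have "degree ([:- z, 1:] * q) = Suc (degree q)" by (subst degree_mult_eq) auto
    moreover have "degree (node_poly n - [:?P z:]) \<le> 2 * n"
      by (intro degree_diff_le) (simp_all add: degree_node_poly)
    ultimately show ?thesis unfolding q by simp
  qed (use assms(3) in simp)
  from quadrature_exact[OF \<nu> this]
  have "(LINT x|\<nu>. poly q (of_real x)) =
      (\<Sum>j = 1..2 * n. of_real (quad_weight \<mu>1 \<mu>2 \<nu> n j) * poly q (of_real (?x j)))" ..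
  also have "\<dots> = ?P z * hp_approx \<mu>1 \<mu>2 \<nu> n z"
    unfolding hp_approx_def sum_distrib_left
  proof (rule sum.cong)
    fix j assume j: "j \<in> {1..2 * n}"
    from q_eq[of "of_real (?x j)"] Pnode[OF j] node_z[OF j]
    show "of_real (quad_weight \<mu>1 \<mu>2 \<nu> n j) * poly q (of_real (?x j))
        = ?P z * (of_real (quad_weight \<mu>1 \<mu>2 \<nu> n j) / (z - of_real (?x j)))" by simp
  qed simp
  finally have 1: "(LINT x|\<nu>. poly q (of_real x)) = ?P z * hp_approx \<mu>1 \<mu>2 \<nu> n z" .
  have zx: "of_real x \<noteq> z" if "x \<in> {a..b}" for x using that sub z by blast
  have int: "set_integrable \<nu> {a..b} (\<lambda>x. ?P z * (1 / (z - of_real x)))"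
    "set_integrable \<nu> {a..b} (\<lambda>x. ?P (of_real x) / (z - of_real x))"
    by (auto intro!: set_integrable_continuous continuous_intros dest: zx simp del: atLeastAtMost_iff)
  have "continuous_on UNIV (\<lambda>x::real. poly q (of_real x))" by (intro continuous_intros)
  then have "(LINT x|\<nu>. poly q (of_real x)) = (LINT x:{a..b}|\<nu>. poly q (of_real x))"
    by (intro set_integral_interval[symmetric] borel_measurable_continuous_onI)
  also have "\<dots> = (LINT x:{a..b}|\<nu>. ?P z * (1 / (z - of_real x)) - ?P (of_real x) / (z - of_real x))"
    using zx q_eq by (intro set_lebesgue_integral_cong) (auto simp: sets_M)
  also have "\<dots> = ?P z * markov_function \<nu> a b z - (LINT x:{a..b}|\<nu>. ?P (of_real x) / (z - of_real x))"
    unfolding set_integral_diff(2)[OF int] by (simp only: markov_function_def set_integral_mult_right)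
  finally show ?thesis
    unfolding 1 using Pz by (simp add: field_simps)
qed

text \<open>Let \<open>L = b2 - a1\<close>. In absolute value, every factor of \<open>P(x)\<close> is at most \<open>L\<close> on \<open>[a1, b2]\<close>, and every factor of
  \<open>P(z)\<close> is at least \<open>L + 1\<close> if \<open>norm z \<ge> R\<close>, so the error is of order \<open>(L / (L + 1)) ^ (2 * n)\<close>.\<close>

lemma hp_approx_converges_far:
  assumes \<nu>: "interval_measure \<nu> a b" and sub: "{a..b} \<subseteq> {a1..b2}"
    and R: "R \<ge> max \<bar>a1\<bar> \<bar>b2\<bar> + (b2 - a1) + 1"
  shows "uniform_limit {z. norm z \<ge> R} (hp_approx \<mu>1 \<mu>2 \<nu>) (markov_function \<nu> a b) sequentially"
proof -
  interpret interval_measure \<nu> a b by fact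
  define L where "L = b2 - a1"
  have L: "L > 0" using a1_less_b1 b1_le_a2 a2_less_b2 by (simp add: L_def)
  have far: "norm (z - of_real x) \<ge> L + 1" if z: "norm z \<ge> R" and x: "x \<in> {a1..b2}"
    for z :: complex and x
  proof -
    have "\<bar>x\<bar> \<le> max \<bar>a1\<bar> \<bar>b2\<bar>" using x by auto
    then show ?thesis using z R norm_triangle_ineq2[of z "of_real x"] by (simp add: L_def)
  qed
  have node: "node \<mu>1 \<mu>2 n j \<in> {a1..b2}" if "j \<in> {1..2 * n}" for n j
    using node_mem[OF that] b1_le_a2 a1_less_b1 a2_less_b2 by auto
  have bound: "norm (hp_approx \<mu>1 \<mu>2 \<nu> n z - markov_function \<nu> a b z)
      \<le> (L / (L + 1)) ^ (2 * n) * measure \<nu> UNIV" if n: "n > 0" and z: "norm z \<ge> R" for n z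
  proof -
    let ?P = "poly (node_poly n)"
    have z': "z \<notin> of_real ` {a1..b2}" using far[OF z] L by force
    have "(\<Prod>j\<in>{1..2 * n}. L + 1) \<le> norm (?P z)"
      unfolding poly_node_poly prod_norm[symmetric]
      using L far[OF z node] by (intro prod_mono) auto
    then have lower: "(L + 1) ^ (2 * n) \<le> norm (?P z)" by simp
    have upper: "norm (?P (of_real x)) \<le> L ^ (2 * n)" if "x \<in> {a..b}" for x
    proof -
      have "norm (?P (of_real x)) = (\<Prod>j\<in>{1..2 * n}. \<bar>x - node \<mu>1 \<mu>2 n j\<bar>)"
        unfolding poly_node_poly prod_norm[symmetric] of_real_diff[symmetric] norm_of_real ..
      also have "\<dots> \<le> (\<Prod>j\<in>{1..2 * n}. L)"
      proof (intro prod_mono conjI abs_ge_zero)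
        fix j assume "j \<in> {1..2 * n}"
        then show "\<bar>x - node \<mu>1 \<mu>2 n j\<bar> \<le> L"
          using node[of j n] subsetD[OF sub that] by (auto simp: L_def abs_le_iff)
      qed
      finally show ?thesis by simp
    qed
    have zx: "of_real x \<noteq> z" if "x \<in> {a..b}" for x using that sub z' by blast
    have "norm (LINT x:{a..b}|\<nu>. ?P (of_real x) / (z - of_real x)) \<le> L ^ (2 * n) * measure \<nu> UNIV"
    proof (rule norm_set_integral_le)
      show "continuous_on {a..b} (\<lambda>x. ?P (of_real x) / (z - of_real x))"
        by (auto intro!: continuous_intros dest: zx simp del: atLeastAtMost_iff)
      fix x assume x: "x \<in> {a..b}"
      have "norm (?P (of_real x) / (z - of_real x)) \<le> L ^ (2 * n) / 1"
        unfolding norm_divide using upper[OF x] far[OF z subsetD[OF sub x]] L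
        by (intro frac_le) auto
      then show "norm (?P (of_real x) / (z - of_real x)) \<le> L ^ (2 * n)" by simp
    qed (use L in simp)
    then have "norm (hp_approx \<mu>1 \<mu>2 \<nu> n z - markov_function \<nu> a b z)
        \<le> (L ^ (2 * n) * measure \<nu> UNIV) / (L + 1) ^ (2 * n)"
      unfolding hp_approx_error[OF \<nu> sub n z'] norm_divide norm_minus_cancel
      using lower L by (intro frac_le) auto
    then show ?thesis by (simp add: power_divide)
  qed
  have "(\<lambda>n. (L / (L + 1)) ^ (2 * n) * measure \<nu> UNIV) \<longlonglongrightarrow> 0 * measure \<nu> UNIV"
  proof (intro tendsto_mult tendsto_const)
    have "(\<lambda>n. ((L / (L + 1)) ^ 2) ^ n) \<longlonglongrightarrow> 0"
      using L by (intro LIMSEQ_realpow_zero power_less_one_iff[THEN iffD2]) auto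
    then show "(\<lambda>n. (L / (L + 1)) ^ (2 * n)) \<longlonglongrightarrow> 0" by (simp add: power_mult)
  qed
  then have lim: "(\<lambda>n. (L / (L + 1)) ^ (2 * n) * measure \<nu> UNIV) \<longlonglongrightarrow> 0" by simp
  show ?thesis
  proof (rule uniform_limitI)
    fix e :: real assume "e > 0"
    from order_tendstoD(2)[OF lim this] eventually_gt_at_top[of 0]
    show "\<forall>\<^sub>F n in sequentially. \<forall>z\<in>{z. norm z \<ge> R}.
        dist (hp_approx \<mu>1 \<mu>2 \<nu> n z) (markov_function \<nu> a b z) < e"
    proof eventually_elim
      case (elim n)
      with bound[of n] show ?case by (auto simp: dist_norm intro: le_less_trans)
    qed
  qed
qed

section \<open>Convergence of the quadrature formulas\<close>

text \<open>The sum and the integral are written as contour integrals over the sides \<open>J\<close> that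
  \<open>cauchy_formula_compact\<close> gives for \<open>K = E \<inter> cball 0 R\<close>. These sides avoid \<open>K\<close> but may meet \<open>E\<close>
  outside the disc; there the convergence far from the intervals takes over.\<close>

lemma quadrature_converges:
  assumes \<nu>: "interval_measure \<nu> a b" and sub: "{a..b} \<subseteq> {a1..b1} \<union> {a2..b2}"
    and "closed E" and E: "of_real ` ({a1..b1} \<union> {a2..b2}) \<subseteq> E"
    and conv: "\<And>K. compact K \<Longrightarrow> K \<subseteq> - E \<Longrightarrow>
                 uniform_limit K (hp_approx \<mu>1 \<mu>2 \<nu>) (markov_function \<nu> a b) sequentially"
    and "open D" "E \<subseteq> D" and holf: "f holomorphic_on D"
  shows "(\<lambda>n. \<Sum>j = 1..2*n. of_real (quad_weight \<mu>1 \<mu>2 \<nu> n j) * f (of_real (node \<mu>1 \<mu>2 n j)))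
           \<longlonglongrightarrow> (LINT x:{a..b}|\<nu>. f (of_real x))"
proof -
  interpret interval_measure \<nu> a b by fact
  define R where "R = max \<bar>a1\<bar> \<bar>b2\<bar> + (b2 - a1) + 1"
  have sub': "{a1..b1} \<union> {a2..b2} \<subseteq> {a1..b2}"
    using a1_less_b1 b1_le_a2 a2_less_b2 by auto
  have "a1 < b2" using a1_less_b1 b1_le_a2 a2_less_b2 by simp
  define K where "K = E \<inter> cball 0 R"
  have K: "compact K" unfolding K_def using \<open>closed E\<close> by (intro closed_Int_compact) auto
  have KD: "K \<subseteq> D" using \<open>E \<subseteq> D\<close> by (auto simp: K_def)
  have intK: "of_real x \<in> K" if "x \<in> {a1..b1} \<union> {a2..b2}" for x
  proof -
    have "x \<in> {a1..b2}" using that sub' by blast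
    then have "\<bar>x\<bar> \<le> R" using \<open>a1 < b2\<close> by (auto simp: R_def)
    moreover have "of_real x \<in> E" using that E by blast
    ultimately show ?thesis by (simp add: K_def)
  qed
  have nodeK: "of_real (node \<mu>1 \<mu>2 n j) \<in> K" if "j \<in> {1..2 * n}" for n j
  proof -
    have "{a1<..<b1} \<union> {a2<..<b2} \<subseteq> {a1..b1} \<union> {a2..b2}" by auto
    then show ?thesis using node_mem[OF that] by (intro intK) blast
  qed
  have convK: "uniform_limit S (hp_approx \<mu>1 \<mu>2 \<nu>) (markov_function \<nu> a b) sequentially"
    if S: "compact S" "S \<inter> K = {}" for S
  proof -
    have "uniform_limit (S \<inter> cball 0 R) (hp_approx \<mu>1 \<mu>2 \<nu>) (markov_function \<nu> a b) sequentially"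
      using S by (intro conv) (auto simp: K_def)
    moreover have "uniform_limit {z. norm z \<ge> R} (hp_approx \<mu>1 \<mu>2 \<nu>) (markov_function \<nu> a b) sequentially"
      using sub sub' by (intro hp_approx_converges_far[OF \<nu>]) (auto simp: R_def)
    ultimately have "uniform_limit (S \<inter> cball 0 R \<union> {z. norm z \<ge> R})
        (hp_approx \<mu>1 \<mu>2 \<nu>) (markov_function \<nu> a b) sequentially"
      by (rule uniform_limit_on_Un)
    then show ?thesis by (rule uniform_limit_on_subset) auto
  qed
  obtain J where J: "finite J"
    and JK: "\<And>e. e \<in> J \<Longrightarrow> closed_segment (fst e) (snd e) \<subseteq> D - K"
    and cauchy: "\<And>z. z \<in> K \<Longrightarrow> 2 * pi * \<i> * f z = (\<Sum>e\<in>J. edge_integral e (\<lambda>w. f w / (w - z)))"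
    using cauchy_formula_compact[OF K \<open>open D\<close> KD holf] by blast
  let ?w = "\<lambda>n j. complex_of_real (quad_weight \<mu>1 \<mu>2 \<nu> n j)"
  let ?x = "\<lambda>n j. complex_of_real (node \<mu>1 \<mu>2 n j)"
  let ?h = "hp_approx \<mu>1 \<mu>2 \<nu>" and ?g = "markov_function \<nu> a b"
  have contf: "continuous_on (closed_segment (fst e) (snd e)) f" if "e \<in> J" for e
    using holomorphic_on_imp_continuous_on[OF holf] JK[OF that] by (auto elim: continuous_on_subset)
  have off: "w \<noteq> z" if "e \<in> J" "w \<in> closed_segment (fst e) (snd e)" "z \<in> K" for e w z
    using JK[OF that(1)] that(2,3) by blast
  have conth: "continuous_on (closed_segment (fst e) (snd e)) (?h n)" if e: "e \<in> J" for e n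
    unfolding hp_approx_def using off[OF e _ nodeK]
    by (intro continuous_intros) auto
  have quad: "2 * pi * \<i> * (\<Sum>j = 1..2*n. ?w n j * f (?x n j))
      = (\<Sum>e\<in>J. edge_integral e (\<lambda>z. f z * ?h n z))" for n
  proof -
    have "2 * pi * \<i> * (\<Sum>j = 1..2*n. ?w n j * f (?x n j))
        = (\<Sum>j = 1..2*n. ?w n j * (\<Sum>e\<in>J. edge_integral e (\<lambda>z. f z / (z - ?x n j))))"
    proof (subst sum_distrib_left, rule sum.cong[OF refl])
      fix j assume "j \<in> {1..2*n}"
      from cauchy[OF nodeK[OF this], symmetric]
      show "2 * pi * \<i> * (?w n j * f (?x n j))
          = ?w n j * (\<Sum>e\<in>J. edge_integral e (\<lambda>z. f z / (z - ?x n j)))" by simp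
    qed
    also have "\<dots> = (\<Sum>e\<in>J. \<Sum>j = 1..2*n. ?w n j * edge_integral e (\<lambda>z. f z / (z - ?x n j)))"
      unfolding sum_distrib_left by (rule sum.swap)
    also have "\<dots> = (\<Sum>e\<in>J. edge_integral e (\<lambda>z. f z * ?h n z))"
    proof (rule sum.cong[OF refl])
      fix e assume e: "e \<in> J"
      have int: "(\<lambda>z. f z / (z - ?x n j)) contour_integrable_on linepath (fst e) (snd e)"
        if "j \<in> {1..2 * n}" for j
        using off[OF e _ nodeK[OF that]] contf[OF e]
        by (intro contour_integrable_continuous_linepath continuous_intros) auto
      have "edge_integral e (\<lambda>z. f z * ?h n z)
          = edge_integral e (\<lambda>z. \<Sum>j = 1..2*n. ?w n j * (f z / (z - ?x n j)))"
        by (simp add: hp_approx_def sum_distrib_left mult.commute)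
      also have "\<dots> = (\<Sum>j = 1..2*n. edge_integral e (\<lambda>z. ?w n j * (f z / (z - ?x n j))))"
        by (intro contour_integral_sum contour_integrable_lmul int) auto
      also have "\<dots> = (\<Sum>j = 1..2*n. ?w n j * edge_integral e (\<lambda>z. f z / (z - ?x n j)))"
        by (intro sum.cong refl contour_integral_lmul int)
      finally show "(\<Sum>j = 1..2*n. ?w n j * edge_integral e (\<lambda>z. f z / (z - ?x n j)))
          = edge_integral e (\<lambda>z. f z * ?h n z)" ..
    qed
    finally show ?thesis .
  qed
  have meas: "2 * pi * \<i> * (LINT x:{a..b}|\<nu>. f (of_real x))
      = (\<Sum>e\<in>J. edge_integral e (\<lambda>z. f z * ?g z))"
  proof -
    have xK: "of_real x \<in> K" if "x \<in> {a..b}" for x using that sub by (intro intK) blast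
    have int: "set_integrable \<nu> {a..b} (\<lambda>x. edge_integral e (\<lambda>z. f z / (z - of_real x)))"
      if e: "e \<in> J" for e
    proof (rule set_integrable_continuous)
      show "continuous_on {a..b} (\<lambda>x. edge_integral e (\<lambda>z. f z / (z - of_real x)))"
        by (rule continuous_on_compose2[OF continuous_on_cauchy_transform_linepath[OF contf[OF e]]])
           (use off[OF e _ xK] in \<open>auto intro!: continuous_intros simp del: atLeastAtMost_iff\<close>)
    qed
    have "2 * pi * \<i> * (LINT x:{a..b}|\<nu>. f (of_real x))
        = (LINT x:{a..b}|\<nu>. 2 * pi * \<i> * f (of_real x))"
      by (rule set_integral_mult_right[symmetric])
    also have "\<dots> = (LINT x:{a..b}|\<nu>. (\<Sum>e\<in>J. edge_integral e (\<lambda>z. f z / (z - of_real x))))"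
      using cauchy xK by (intro set_lebesgue_integral_cong) (auto simp: sets_M)
    also have "\<dots> = (\<Sum>e\<in>J. (LINT x:{a..b}|\<nu>. edge_integral e (\<lambda>z. f z / (z - of_real x))))"
      using int unfolding set_lebesgue_integral_def set_integrable_def scaleR_sum_right
      by (rule Bochner_Integration.integral_sum)
    also have "\<dots> = (\<Sum>e\<in>J. edge_integral e (\<lambda>z. f z * ?g z))"
    proof (intro sum.cong refl contour_integral_markov_function[symmetric] contf)
      fix e assume "e \<in> J"
      from JK[OF this] xK show "closed_segment (fst e) (snd e) \<inter> of_real ` {a..b} = {}" by blast
    qed
    finally show ?thesis .
  qed
  have "(\<lambda>n. \<Sum>e\<in>J. edge_integral e (\<lambda>z. f z * ?h n z))
      \<longlonglongrightarrow> (\<Sum>e\<in>J. edge_integral e (\<lambda>z. f z * ?g z))"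
  proof (rule tendsto_sum)
    fix e assume e: "e \<in> J"
    let ?s = "closed_segment (fst e) (snd e)"
    have lim: "uniform_limit ?s ?h ?g sequentially"
      using JK[OF e] by (intro convK) auto
    have "continuous_on ?s ?g"
      by (rule uniform_limit_theorem[OF _ lim]) (use conth[OF e] in auto)
    then have bounded: "bounded (f ` ?s)" "bounded (?g ` ?s)"
      using contf[OF e] by (auto intro!: compact_imp_bounded compact_continuous_image)
    have "uniform_limit ?s (\<lambda>n z. f z * ?h n z) (\<lambda>z. f z * ?g z) sequentially"
      by (rule uniform_lim_mult[OF uniform_limit_const lim bounded])
    then have ul: "uniform_limit (path_image (linepath (fst e) (snd e)))
        (\<lambda>n z. f z * ?h n z) (\<lambda>z. f z * ?g z) sequentially" by simp
    have ev: "\<forall>\<^sub>F n in sequentially. (\<lambda>z. f z * ?h n z) contour_integrable_on linepath (fst e) (snd e)"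
      using conth[OF e] contf[OF e]
      by (intro always_eventually allI contour_integrable_continuous_linepath continuous_intros) auto
    show "(\<lambda>n. edge_integral e (\<lambda>z. f z * ?h n z)) \<longlonglongrightarrow> edge_integral e (\<lambda>z. f z * ?g z)"
      by (rule contour_integral_uniform_limit(2)[OF ev ul, where B = "norm (snd e - fst e)"]) auto
  qed
  then have "(\<lambda>n. 2 * pi * \<i> * (\<Sum>j = 1..2*n. ?w n j * f (?x n j)) / (2 * pi * \<i>))
      \<longlonglongrightarrow> 2 * pi * \<i> * (LINT x:{a..b}|\<nu>. f (of_real x)) / (2 * pi * \<i>)"
    unfolding quad[symmetric] meas[symmetric] by (intro tendsto_divide tendsto_const) auto
  then show ?thesis by simp
qed

end

theorem theorem3p4:
  fixes \<mu>1 \<mu>2 :: "real measure"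
    and a1 b1 a2 b2 :: real
    and E D :: "complex set"
    and f :: "complex \<Rightarrow> complex"
  assumes "angelesco_system \<mu>1 \<mu>2 a1 b1 a2 b2"
    and "closed E"
    and "of_real ` ({a1..b1} \<union> {a2..b2}) \<subseteq> E"
    and "\<And>K. compact K \<Longrightarrow> K \<subseteq> - E \<Longrightarrow>
           uniform_limit K (hp_approx \<mu>1 \<mu>2 \<mu>1) (markov_function \<mu>1 a1 b1) sequentially"
    and "\<And>K. compact K \<Longrightarrow> K \<subseteq> - E \<Longrightarrow>
           uniform_limit K (hp_approx \<mu>1 \<mu>2 \<mu>2) (markov_function \<mu>2 a2 b2) sequentially"
    and "open D" and "connected D" and "E \<subseteq> D"
    and "f analytic_on D"
  shows "(\<lambda>n. \<Sum>j = 1..2*n. of_real (quad_weight \<mu>1 \<mu>2 \<mu>1 n j) * f (of_real (node \<mu>1 \<mu>2 n j)))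
           \<longlonglongrightarrow> (LINT x:{a1..b1}|\<mu>1. f (of_real x)) \<and>
         (\<lambda>n. \<Sum>j = 1..2*n. of_real (quad_weight \<mu>1 \<mu>2 \<mu>2 n j) * f (of_real (node \<mu>1 \<mu>2 n j)))
           \<longlonglongrightarrow> (LINT x:{a2..b2}|\<mu>2. f (of_real x))"
proof -
  interpret angelesco \<mu>1 \<mu>2 a1 b1 a2 b2
    using assms(1)
    by (simp add: angelesco_system_def angelesco_def interval_measure_def
          interval_measure_axioms_def angelesco_axioms_def)
  have holf: "f holomorphic_on D" by (rule analytic_imp_holomorphic[OF assms(9)])
  note conv = quadrature_converges[OF _ _ assms(2,3) _ assms(6,8) holf]
  show ?thesis
    by (intro conjI conv assms(4,5) \<mu>1.interval_measure_axioms \<mu>2.interval_measure_axioms) auto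
qed

end
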